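(* Let $f\in F$, where $F$ is Thompson's group, and suppose that $g\in F$ commutes with $f$. Then: * for each bump chain $D_1,\dots,D_s$ of $f$, the restriction of $g$ to the bump chain is a root of the restriction of $f^p$ for some integer $p$; that is, there are an integer $p$ and a positive integer $q$ such that $(g|_{D_i})^q=(f|_{D_i})^p$ for $i=1,\dots,s$; * for each maximal connected open subset $C$ of $\mathrm{fix}(f)$, the restriction of $g$ to $C$ is the restriction to $C$ of an element of $F_C$, and it may be any element of $F_C$ (every element of $F_C$ occurs in this way for some $g\in F$ commuting with $f$). Consequently the centralizer $C_F(f)=\{g\in F: gf=fg\}$ satisfies $$C_F(f)\cong F^a\times\mathbb{Z}^b,$$ where $a$ is the number of non-empty maximal connected open subsets of $\mathrm{fix}(f)$ and $b$ is the number of bump chains of $f$.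
   Context: $\mathrm{PL}^+(0,1)$ is the group (under composition) of piecewise linear order-preserving homeomorphisms of $(0,1)$ with finitely many nodes, where a node of $f$ is a point at which $f$ is not locally affine. Thompson's group $F$ is the subgroup of those $f$ all of whose nodes lie in $\mathbb{Z}[\frac12]$ and for which $f'(x)$ is an integer power of $2$ whenever $x$ is not a node. Dyadic means lying in $\mathbb{Z}[\frac12]$. $\mathrm{fix}(f)$ is the set of fixed points of $f$ in $(0,1)$; its non-empty maximal connected open subsets are the connected components of its interior (they are open intervals with dyadic end-points). The bump domains of $f$ are the connected components of $(0,1)\setminus\mathrm{fix}(f)$. Let $I_1,\dots,I_m$, $I_j=(p_{j-1},p_j)$, $p_0=0$, $p_m=1$, be the connected components, from left to right, of $(0,1)$ minus the topological boundary of $\mathrm{fix}(f)$ in $(0,1)$; each $I_j$ is either a bump domain or a component of the interior of $\mathrm{fix}(f)$. A bump chain of $f$ is a run of consecutive intervals $I_t,I_{t+1},\dots,I_u$, all bump domains, such that of the points $p_{t-1},p_t,\dots,p_u$ exactly $p_{t-1}$ and $p_u$ are dyadic. For an interval $C=(c,d)$ with $c,d\in\mathbb{Z}[\frac12]\cap[0,1]$, $F_C$ is the group of those elements of $F$ which fix every $x\notin C$. *)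

theory Defs
  imports "HOL-Analysis.Analysis" "HOL-Algebra.Bij" "HOL-Algebra.Product_Groups"
begin

definition dyadic :: "real set" where
  "dyadic = {x. \<exists>(a::int) (n::nat). x = of_int a / 2 ^ n}"

definition nodes :: "(real \<Rightarrow> real) \<Rightarrow> real set" where
  "nodes f = {x \<in> {0<..<1}. \<not> (\<exists>a b. \<forall>\<^sub>F y in nhds x. f y = a * y + b)}"

text \<open>Elements of the groups below are functions on the open unit interval, represented
  extensionally (with value \<^const>\<open>undefined\<close> outside it), as in \<^const>\<open>BijGroup\<close>;
  the product of \<open>g\<close> and \<open>f\<close> is \<open>g\<close> after \<open>f\<close>.\<close>

definition PL_plus :: "(real \<Rightarrow> real) monoid" where
  "PL_plus = (BijGroup {0<..<1})
     \<lparr>carrier := {f \<in> extensional {0<..<1}.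
        (\<exists>h. homeomorphism {0<..<1} {0<..<1} f h) \<and> mono_on {0<..<1} f \<and> finite (nodes f)}\<rparr>"

definition Thompson_F :: "(real \<Rightarrow> real) monoid" where
  "Thompson_F = PL_plus
     \<lparr>carrier := {f \<in> carrier PL_plus. nodes f \<subseteq> dyadic \<and>
        (\<forall>x \<in> {0<..<1} - nodes f. \<exists>k::int. (f has_real_derivative 2 powi k) (at x))}\<rparr>"

definition centralizer :: "('a, 'b) monoid_scheme \<Rightarrow> 'a \<Rightarrow> 'a set" where
  "centralizer G a = {g \<in> carrier G. g \<otimes>\<^bsub>G\<^esub> a = a \<otimes>\<^bsub>G\<^esub> g}"

text \<open>This is used only for \<open>C\<close> an open interval with dyadic end-points.\<close>

definition Thompson_F_on :: "real set \<Rightarrow> (real \<Rightarrow> real) set" where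
  "Thompson_F_on C = {h \<in> carrier Thompson_F. \<forall>x \<in> {0<..<1} - C. h x = x}"

definition fixpts :: "(real \<Rightarrow> real) \<Rightarrow> real set" where
  "fixpts f = {x \<in> {0<..<1}. f x = x}"

definition fix_domains :: "(real \<Rightarrow> real) \<Rightarrow> real set set" where
  "fix_domains f = {C. C \<noteq> {} \<and> open C \<and> connected C \<and> C \<subseteq> fixpts f \<and>
     (\<forall>C'. open C' \<and> connected C' \<and> C \<subseteq> C' \<and> C' \<subseteq> fixpts f \<longrightarrow> C' = C)}"

lemma fix_domains_eq_components: "fix_domains f = components (interior (fixpts f))"
proof (intro Set.set_eqI iffI)
  fix C assume "C \<in> fix_domains f"
  then have C: "C \<noteq> {}" "open C" "connected C" "C \<subseteq> fixpts f"
    and mx: "\<And>C'. \<lbrakk>open C'; connected C'; C \<subseteq> C'; C' \<subseteq> fixpts f\<rbrakk> \<Longrightarrow> C' = C"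
    by (auto simp: fix_domains_def)
  have sub: "C \<subseteq> interior (fixpts f)"
    by (rule interior_maximal[OF C(4) C(2)])
  show "C \<in> components (interior (fixpts f))"
    unfolding in_components_maximal
  proof (intro conjI allI impI)
    fix D assume D: "D \<noteq> {} \<and> C \<subseteq> D \<and> D \<subseteq> interior (fixpts f) \<and> connected D"
    obtain E where E: "E \<in> components (interior (fixpts f))" "D \<subseteq> E"
      using exists_component_superset[of D "interior (fixpts f)"] D C(1) by auto
    have "open E" "connected E" "E \<subseteq> fixpts f"
      using open_components[OF open_interior E(1)] in_components_connected[OF E(1)]
        order_trans[OF in_components_subset[OF E(1)] interior_subset] by auto
    then have "E = C"
      using mx D E(2) by auto
    then show "D = C"
      using D E(2) by auto
  qed (use C sub in auto)
next
  fix C assume C: "C \<in> components (interior (fixpts f))"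
  have "C' = C" if "open C'" "connected C'" "C \<subseteq> C'" "C' \<subseteq> fixpts f" for C'
  proof -
    have "C' \<subseteq> interior (fixpts f)"
      by (rule interior_maximal[OF that(4,1)])
    moreover have "C' \<noteq> {}"
      using in_components_nonempty[OF C] that(3) by auto
    ultimately show ?thesis
      using that C[unfolded in_components_maximal] by auto
  qed
  then show "C \<in> fix_domains f"
    unfolding fix_domains_def
    using in_components_nonempty[OF C] open_components[OF open_interior C]
      in_components_connected[OF C] order_trans[OF in_components_subset[OF C] interior_subset]
    by auto
qed

definition bump_domains :: "(real \<Rightarrow> real) \<Rightarrow> real set set" where
  "bump_domains f = components ({0<..<1} - fixpts f)"

text \<open>The components \<open>I\<^sub>1, \<dots>, I\<^sub>m\<close> of the complement of the boundary of the fixed-point set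
  are, from left to right, the intervals from \<open>p (j - 1)\<close> to \<open>p j\<close>.\<close>

definition division :: "(real \<Rightarrow> real) \<Rightarrow> nat \<Rightarrow> (nat \<Rightarrow> real) \<Rightarrow> bool" where
  "division f m p \<longleftrightarrow> p 0 = 0 \<and> p m = 1 \<and> strict_mono_on {0..m} p \<and>
     (\<lambda>j. {p (j - 1)<..<p j}) ` {1..m} =
       components ({0<..<1} - (top_of_set {0<..<1} frontier_of fixpts f))"

text \<open>A bump chain is given as the list of its intervals, from left to right.\<close>

definition bump_chains :: "(real \<Rightarrow> real) \<Rightarrow> real set list set" where
  "bump_chains f = {Ds. \<exists>m p t u. division f m p \<and> 1 \<le> t \<and> t \<le> u \<and> u \<le> m \<and>
     (\<forall>j \<in> {t..u}. {p (j - 1)<..<p j} \<in> bump_domains f) \<and>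
     (\<forall>j \<in> {t - 1..u}. p j \<in> dyadic \<longleftrightarrow> j = t - 1 \<or> j = u) \<and>
     Ds = map (\<lambda>j. {p (j - 1)<..<p j}) [t..<Suc u]}"

end

theory Submission
  imports Defs
begin

text \<open>A \<open>g\<close> commuting with \<open>f\<close> permutes the finite boundary of \<open>fix(f)\<close> in an order-preserving way, so it
  fixes every boundary point and preserves each interval between consecutive dyadic boundary points.
  Such an interval is either a fix domain, where commuting with \<open>f\<close> is no constraint, or the span of a
  bump chain. On the span of a chain, \<open>g\<close> is determined by its slope at the left end: if this slope is 1
  and \<open>g\<close> is not the identity there, then the infimum of the points moved by \<open>g\<close> is fixed by \<open>f\<close>, hence
  not dyadic, hence not a node of \<open>g\<close>, which is absurd. The logarithm of this slope therefore embeds the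
  restrictions to the chain into the integers, with \<open>f\<close> having non-zero image, and yields the roots and
  the infinite cyclic factors. Gluing at dyadic points makes the restrictions independent.\<close>

section \<open>Maps with dyadic breaks and slopes powers of two\<close>

text \<open>The cuts are made at dyadic boundary points only, because the slopes of an element of F
  on the two sides of a point can be chosen independently exactly when the point is dyadic. At a
  non-dyadic boundary point the element is affine, so its action on one side forces its action on
  the other; this ties the bump domains of a chain into one infinite cyclic factor. The definition
  of F restricts nodes and slopes but is silent about values at dyadic points, whereas closure under
  products and inverses rests on dyadic points, and no others, going to dyadic points.
  \<open>pl2_bij\<close> carries this as a clause, and \<open>dyadic_preserved\<close> derives it
  for F. Domain and target of \<open>pl2_bij\<close> may differ, so one notion serves for elements
  of F, for their restrictions to gaps and for the charts that transport F to a gap. On a chain the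
  exponents of the slopes form a non-zero subgroup of the integers whose generator n is not known
  explicitly; the coordinate on the chain is therefore the exponent divided by n.\<close>

lemma dyadic_of_int [simp]: "of_int a \<in> dyadic"
  unfolding dyadic_def by (intro CollectI exI[of _ a] exI[of _ 0]) simp

lemma dyadic_0 [simp]: "0 \<in> dyadic" and dyadic_1 [simp]: "1 \<in> dyadic"
  using dyadic_of_int[of 0] dyadic_of_int[of 1] by simp_all

lemma dyadic_minus: "x \<in> dyadic \<Longrightarrow> - x \<in> dyadic"
  unfolding dyadic_def by clarsimp (metis minus_divide_left of_int_minus)

lemma dyadic_add:
  assumes "x \<in> dyadic" "y \<in> dyadic" shows "x + y \<in> dyadic"
proof -
  obtain a n b m where "x = of_int a / 2 ^ n" "y = of_int b / 2 ^ m"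
    using assms by (auto simp: dyadic_def)
  then have "x + y = of_int (a * 2 ^ m + b * 2 ^ n) / 2 ^ (n + m)"
    by (simp add: add_divide_distrib power_add)
  then show ?thesis unfolding dyadic_def by blast
qed

lemma dyadic_diff: "x \<in> dyadic \<Longrightarrow> y \<in> dyadic \<Longrightarrow> x - y \<in> dyadic"
  using dyadic_add[of x "- y"] dyadic_minus[of y] by simp

lemma dyadic_mult:
  assumes "x \<in> dyadic" "y \<in> dyadic" shows "x * y \<in> dyadic"
proof -
  obtain a n b m where "x = of_int a / 2 ^ n" "y = of_int b / 2 ^ m"
    using assms by (auto simp: dyadic_def)
  then have "x * y = of_int (a * b) / 2 ^ (n + m)"
    by (simp add: power_add)
  then show ?thesis unfolding dyadic_def by blast
qed

lemma dyadic_powi [simp]: "2 powi k \<in> dyadic"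
proof (cases "k \<ge> 0")
  case True
  then have "(2::real) powi k = of_int (2 ^ nat k)" by (simp add: power_int_nonneg_exp)
  then show ?thesis using dyadic_of_int[of "2 ^ nat k"] by simp
next
  case False
  then have "(2::real) powi k = of_int 1 / 2 ^ nat (- k)"
    by (simp add: power_int_def field_simps)
  then show ?thesis unfolding dyadic_def by blast
qed

lemma dyadic_add_iff: "y \<in> dyadic \<Longrightarrow> x + y \<in> dyadic \<longleftrightarrow> x \<in> dyadic"
  using dyadic_add[of x y] dyadic_diff[of "x + y" y] by auto

text \<open>Powers of two are units in the ring of dyadic numbers, so scaling by an admissible slope
  neither creates nor destroys dyadicity. A slope such as 3 would not have this property.\<close>

lemma dyadic_powi_mult_iff [simp]: "2 powi k * x \<in> dyadic \<longleftrightarrow> x \<in> dyadic"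
proof -
  have "2 powi - k * (2 powi k * x) = x" by (simp add: power_int_minus)
  then show ?thesis
    using dyadic_mult[OF dyadic_powi, of x k] dyadic_mult[OF dyadic_powi, of "2 powi k * x" "- k"]
    by metis
qed

lemma powi_2_inject [simp]: "(2::real) powi k = 2 powi l \<longleftrightarrow> k = l"
  using power_int_strict_increasing[of k l "2::real"] power_int_strict_increasing[of l k "2::real"]
  by (cases k l rule: linorder_cases) auto

section \<open>Local affinity, and a class of bijections stable under composition, inversion and
  gluing\<close>

definition locally_affine2 :: "(real \<Rightarrow> real) \<Rightarrow> real \<Rightarrow> bool" where
  "locally_affine2 f x \<longleftrightarrow> (\<exists>(k::int) b. \<forall>\<^sub>F y in nhds x. f y = 2 powi k * y + b)"

text \<open>Continuity is not a clause: an increasing bijection onto an open set is continuous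
  (\<open>strict_mono_bij_continuous_on\<close>). The finite set \<open>S\<close> need only contain
  the breaks, so it can be enlarged freely when maps are composed or glued.\<close>

definition pl2_bij :: "real set \<Rightarrow> real set \<Rightarrow> (real \<Rightarrow> real) \<Rightarrow> bool" where
  "pl2_bij A B f \<longleftrightarrow> bij_betw f A B \<and> strict_mono_on A f \<and>
     (\<forall>x\<in>A. f x \<in> dyadic \<longleftrightarrow> x \<in> dyadic) \<and>
     (\<exists>S. finite S \<and> S \<subseteq> dyadic \<and> (\<forall>x \<in> A - S. locally_affine2 f x))"

lemma pl2_bijD:
  assumes "pl2_bij A B f"
  shows pl2_bij_betw: "bij_betw f A B" and pl2_bij_mono: "strict_mono_on A f"
    and pl2_bij_dyadic: "x \<in> A \<Longrightarrow> f x \<in> dyadic \<longleftrightarrow> x \<in> dyadic"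
    and pl2_bij_image: "f ` A = B" and pl2_bij_inj: "inj_on f A"
    and pl2_bij_in: "x \<in> A \<Longrightarrow> f x \<in> B"
    and pl2_bij_locally_affine2: "x \<in> A \<Longrightarrow> x \<notin> dyadic \<Longrightarrow> locally_affine2 f x"
  using assms by (auto simp: pl2_bij_def bij_betw_def)

lemma locally_affine2_cong:
  assumes "\<forall>\<^sub>F y in nhds x. f y = g y"
  shows "locally_affine2 f x \<longleftrightarrow> locally_affine2 g x"
proof -
  have "(\<forall>\<^sub>F y in nhds x. f y = 2 powi k * y + b) \<longleftrightarrow> (\<forall>\<^sub>F y in nhds x. g y = 2 powi k * y + b)" for k b
    by (rule eventually_cong[OF assms]) simp
  then show ?thesis by (simp add: locally_affine2_def)
qed

lemma locally_affine2_id [simp]: "locally_affine2 (\<lambda>x. x) x"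
  unfolding locally_affine2_def by (rule exI[of _ 0], rule exI[of _ 0]) simp

lemma locally_affine2_isCont: "locally_affine2 f x \<Longrightarrow> isCont f x"
proof -
  assume "locally_affine2 f x"
  then obtain k b where "\<forall>\<^sub>F y in nhds x. f y = 2 powi k * y + b"
    by (auto simp: locally_affine2_def)
  then have "isCont f x \<longleftrightarrow> isCont (\<lambda>y. 2 powi k * y + b) x" by (rule isCont_cong)
  then show ?thesis by simp
qed

lemma locally_affine2_comp:
  assumes "locally_affine2 f x" "locally_affine2 g (f x)"
  shows "locally_affine2 (g \<circ> f) x"
proof -
  obtain k b l c where f: "\<forall>\<^sub>F y in nhds x. f y = 2 powi k * y + b"
    and g: "\<forall>\<^sub>F y in nhds (f x). g y = 2 powi l * y + c"
    using assms by (auto simp: locally_affine2_def)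
  have "filterlim f (nhds (f x)) (nhds x)"
    using locally_affine2_isCont[OF assms(1)] by (simp add: continuous_within tendsto_at_iff_tendsto_nhds)
  then have "\<forall>\<^sub>F y in nhds x. g (f y) = 2 powi l * f y + c"
    by (rule eventually_compose_filterlim[OF g])
  with f have "\<forall>\<^sub>F y in nhds x. (g \<circ> f) y = 2 powi (l + k) * y + (2 powi l * b + c)"
    by eventually_elim (simp add: power_int_add algebra_simps)
  then show ?thesis unfolding locally_affine2_def by blast
qed

text \<open>Only that g undoes f near x is known. Since \<open>?h w\<close>, the inverse of the
  affine germ, tends to x as w tends to \<open>f x\<close>, both the affine formula and this
  relation can be evaluated at \<open>?h w\<close>, which gives \<open>g w = ?h w\<close>.\<close>

lemma locally_affine2_inverse:
  assumes "locally_affine2 f x" "\<forall>\<^sub>F y in nhds x. g (f y) = y"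
  shows "locally_affine2 g (f x)"
proof -
  obtain k b where f: "\<forall>\<^sub>F y in nhds x. f y = 2 powi k * y + b"
    using assms by (auto simp: locally_affine2_def)
  let ?h = "\<lambda>w. 2 powi (- k) * w + (- (2 powi (- k) * b))"
  have hx: "?h (f x) = x" using eventually_nhds_x_imp_x[OF f] by (simp add: power_int_minus field_simps)
  have "filterlim ?h (nhds (?h (f x))) (nhds (f x))" by (intro tendsto_intros filterlim_ident)
  then have lim: "filterlim ?h (nhds x) (nhds (f x))"
    unfolding hx .
  have "\<forall>\<^sub>F w in nhds (f x). g (f (?h w)) = ?h w"
    by (rule eventually_compose_filterlim[OF assms(2) lim])
  moreover have "\<forall>\<^sub>F w in nhds (f x). f (?h w) = 2 powi k * ?h w + b"
    by (rule eventually_compose_filterlim[OF f lim])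
  ultimately have "\<forall>\<^sub>F w in nhds (f x). g w = ?h w"
    by eventually_elim (simp add: power_int_minus field_simps)
  then show ?thesis unfolding locally_affine2_def by blast
qed

lemma pl2_bij_id: "pl2_bij A A (\<lambda>x. x)"
  unfolding pl2_bij_def by (auto intro!: strict_mono_onI simp: bij_betw_def)

lemma pl2_bij_cong:
  assumes "open A" "\<And>x. x \<in> A \<Longrightarrow> f x = g x" "pl2_bij A B f"
  shows "pl2_bij A B g"
proof -
  have aff: "locally_affine2 f x \<longleftrightarrow> locally_affine2 g x" if "x \<in> A" for x
    by (rule locally_affine2_cong, rule eventually_mono[OF eventually_nhds_in_open[OF assms(1) that]])
      (rule assms(2))
  obtain S where "finite S" "S \<subseteq> dyadic" "\<forall>x\<in>A - S. locally_affine2 f x"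
    using assms(3) by (auto simp: pl2_bij_def)
  then have "\<exists>S. finite S \<and> S \<subseteq> dyadic \<and> (\<forall>x\<in>A - S. locally_affine2 g x)"
    using aff by blast
  moreover have "bij_betw g A B"
    using pl2_bij_betw[OF assms(3)] assms(2) by (simp cong: bij_betw_cong)
  moreover have "strict_mono_on A g"
    using pl2_bij_mono[OF assms(3)] assms(2) by (simp add: strict_mono_on_def)
  ultimately show ?thesis
    using pl2_bij_dyadic[OF assms(3)] assms(2) by (simp add: pl2_bij_def)
qed

text \<open>Breaks of the composite lie among the breaks of f and the preimages of the breaks of g;
  those preimages are dyadic because f reflects dyadicity.\<close>

lemma pl2_bij_comp:
  assumes f: "pl2_bij A B f" and g: "pl2_bij B C g"
  shows "pl2_bij A C (g \<circ> f)"
proof -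
  obtain S T where S: "finite S" "S \<subseteq> dyadic" "\<And>x. x \<in> A - S \<Longrightarrow> locally_affine2 f x"
    and T: "finite T" "T \<subseteq> dyadic" "\<And>x. x \<in> B - T \<Longrightarrow> locally_affine2 g x"
    using f g by (auto simp: pl2_bij_def)
  have "finite (f -` T \<inter> A)"
    using T(1) pl2_bij_inj[OF f] by (rule finite_vimage_IntI)
  moreover have "f -` T \<inter> A \<subseteq> dyadic"
    using T(2) pl2_bij_dyadic[OF f] by auto
  moreover have "locally_affine2 (g \<circ> f) x" if "x \<in> A - (S \<union> (f -` T \<inter> A))" for x
    using that S T pl2_bij_in[OF f] by (intro locally_affine2_comp) auto
  ultimately have "\<exists>S. finite S \<and> S \<subseteq> dyadic \<and> (\<forall>x \<in> A - S. locally_affine2 (g \<circ> f) x)"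
    using S by (intro exI[of _ "S \<union> (f -` T \<inter> A)"]) auto
  then show ?thesis
    using bij_betw_trans[OF pl2_bij_betw[OF f] pl2_bij_betw[OF g]] pl2_bij_mono[OF f] pl2_bij_mono[OF g]
      pl2_bij_in[OF f] pl2_bij_dyadic[OF f] pl2_bij_dyadic[OF g]
    by (auto simp: pl2_bij_def strict_mono_on_def)
qed

text \<open>Breaks of the inverse lie among the images of the breaks of f, which are dyadic because
  f preserves dyadicity. Openness of A makes \<open>inv_into\<close> undo f on a whole neighbourhood
  of a point.\<close>

lemma pl2_bij_inv_into:
  assumes f: "pl2_bij A B f" and "open A"
  shows "pl2_bij B A (inv_into A f)"
proof -
  let ?g = "inv_into A f"
  obtain S where S: "finite S" "S \<subseteq> dyadic" "\<And>x. x \<in> A - S \<Longrightarrow> locally_affine2 f x"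
    using f by (auto simp: pl2_bij_def)
  have g: "?g y \<in> A" "f (?g y) = y" if "y \<in> B" for y
    using that pl2_bij_image[OF f] by (auto simp: inv_into_into f_inv_into_f)
  have "locally_affine2 ?g y" if y: "y \<in> B - f ` (S \<inter> A)" for y
  proof -
    have "?g y \<notin> S"
    proof
      assume "?g y \<in> S"
      then have "f (?g y) \<in> f ` (S \<inter> A)" using y g by blast
      then show False using y g by simp
    qed
    then have "?g y \<in> A - S" using y g by blast
    moreover have "\<forall>\<^sub>F z in nhds (?g y). ?g (f z) = z"
      using eventually_nhds_in_open[OF \<open>open A\<close>, of "?g y"] y g[of y] pl2_bij_inj[OF f]
      by (auto elim!: eventually_mono)
    ultimately have "locally_affine2 ?g (f (?g y))"
      using S(3) locally_affine2_inverse by blast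
    then show ?thesis using y g by simp
  qed
  then have "\<exists>S. finite S \<and> S \<subseteq> dyadic \<and> (\<forall>x \<in> B - S. locally_affine2 ?g x)"
    using S pl2_bij_dyadic[OF f] by (intro exI[of _ "f ` (S \<inter> A)"]) auto
  moreover have "strict_mono_on B ?g"
  proof (rule strict_mono_onI)
    fix x y assume xy: "x \<in> B" "y \<in> B" "x < y"
    show "?g x < ?g y"
    proof (rule ccontr)
      assume "\<not> ?g x < ?g y"
      then have "f (?g y) \<le> f (?g x)"
        using strict_mono_on_leD[OF pl2_bij_mono[OF f]] g xy by (meson not_less)
      then show False using g xy by (metis not_less)
    qed
  qed
  moreover have "\<forall>y\<in>B. ?g y \<in> dyadic \<longleftrightarrow> y \<in> dyadic"
    using pl2_bij_dyadic[OF f] g by metis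
  ultimately show ?thesis
    using bij_betw_inv_into[OF pl2_bij_betw[OF f]] by (simp add: pl2_bij_def)
qed

lemma pl2_bij_subset:
  assumes "pl2_bij A B f" "A' \<subseteq> A" "f ` A' = B'"
  shows "pl2_bij A' B' f"
proof -
  obtain S where "finite S" "S \<subseteq> dyadic" "\<forall>x\<in>A - S. locally_affine2 f x"
    using assms(1) by (auto simp: pl2_bij_def)
  then have "\<exists>S. finite S \<and> S \<subseteq> dyadic \<and> (\<forall>x\<in>A' - S. locally_affine2 f x)"
    using assms(2) by blast
  moreover have "strict_mono_on A' f"
    using pl2_bij_mono[OF assms(1)] assms(2) by (auto simp: strict_mono_on_def)
  moreover have "bij_betw f A' B'"
    using inj_on_subset[OF pl2_bij_inj[OF assms(1)] assms(2)] assms(3) by (simp add: bij_betw_def)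
  ultimately show ?thesis
    using pl2_bij_dyadic[OF assms(1)] assms(2) by (auto simp: pl2_bij_def)
qed

lemma pl2_bij_affine:
  assumes "b \<in> dyadic" "f = (\<lambda>x. 2 powi k * x + b)"
  shows "pl2_bij {u<..<v} {2 powi k * u + b<..<2 powi k * v + b} f"
proof -
  have "bij_betw f {u<..<v} {2 powi k * u + b<..<2 powi k * v + b}"
    by (rule bij_betw_byWitness[where f' = "\<lambda>y. (y - b) / 2 powi k"])
      (auto simp: assms field_simps)
  moreover have "locally_affine2 f x" for x
    unfolding assms locally_affine2_def by (intro exI[of _ k] exI[of _ b]) simp
  ultimately show ?thesis
    using assms dyadic_add_iff[OF assms(1)]
    by (auto simp: pl2_bij_def intro!: strict_mono_onI exI[of _ "{}"])
qed

text \<open>The points outside all blocks go into the exceptional set, so they must be finitely many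
  and dyadic. Order between different blocks is kept because each block is an interval mapped onto
  itself.\<close>

lemma pl2_bij_glue:
  assumes fin: "finite \<B>" "finite (U - \<Union>\<B>)" and dy: "U - \<Union>\<B> \<subseteq> dyadic"
    and conv: "\<And>B. B \<in> \<B> \<Longrightarrow> is_interval B" and disj: "pairwise disjnt \<B>"
    and sub: "\<Union>\<B> \<subseteq> U"
    and pl: "\<And>B. B \<in> \<B> \<Longrightarrow> pl2_bij B B g" and id: "\<And>x. x \<in> U - \<Union>\<B> \<Longrightarrow> g x = x"
  shows "pl2_bij U U g"
proof -
  have mono: "strict_mono_on U g"
  proof (rule strict_mono_onI)
    fix x y assume xy: "x \<in> U" "y \<in> U" "x < y"
    \<comment> \<open>The value \<open>g x\<close> stays in the interval B, so reaching or passing y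
      would put y into B.\<close>
    have step: "g x < y" if "B \<in> \<B>" "x \<in> B" "y \<notin> B" "x < y" for B x y
    proof (rule ccontr)
      assume "\<not> g x < y"
      moreover have "g x \<in> B" using pl2_bij_in[OF pl] that by blast
      ultimately show False
        using mem_is_interval_1_I[OF conv[OF that(1)], of x "g x" y] that by simp
    qed
    have step': "x < g y" if "B \<in> \<B>" "y \<in> B" "x \<notin> B" "x < y" for B x y
    proof (rule ccontr)
      assume "\<not> x < g y"
      moreover have "g y \<in> B" using pl2_bij_in[OF pl] that by blast
      ultimately show False
        using mem_is_interval_1_I[OF conv[OF that(1)], of "g y" y x] that by simp
    qed
    show "g x < g y"
    proof (cases "\<exists>B\<in>\<B>. x \<in> B")
      case True
      then obtain B where B: "B \<in> \<B>" "x \<in> B" by blast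
      show ?thesis
      proof (cases "y \<in> B")
        case True
        then show ?thesis using B pl2_bij_mono[OF pl[OF B(1)]] xy by (auto simp: strict_mono_on_def)
      next
        case False
        then have gx: "g x < y" using step B xy by blast
        show ?thesis
        proof (cases "\<exists>B'\<in>\<B>. y \<in> B'")
          case True
          then obtain B' where B': "B' \<in> \<B>" "y \<in> B'" by blast
          \<comment> \<open>With x and y in different blocks, \<open>g x\<close> takes the place of
            x: it is still left of y and outside the block of y.\<close>
          have "g x \<in> B" using pl2_bij_in[OF pl] B by blast
          then have "g x \<notin> B'" using disj B B' False by (auto simp: pairwise_def disjnt_def)
          then show ?thesis using step' B' gx by blast
        next
          case False
          then show ?thesis using id xy gx by auto
        qed
      qed
    next
      case False
      then have "g x = x" using id xy by auto
      moreover have "x < g y"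
        using step'[of _ y x] id[of y] False xy by (cases "\<exists>B'\<in>\<B>. y \<in> B'") auto
      ultimately show ?thesis by simp
    qed
  qed
  have "g ` U = g ` (U - \<Union>\<B>) \<union> (\<Union>B\<in>\<B>. g ` B)" using sub by blast
  also have "\<dots> = (U - \<Union>\<B>) \<union> \<Union>\<B>" using id pl2_bij_image[OF pl] by simp
  finally have im: "g ` U = U" using sub by blast
  have "\<forall>B\<in>\<B>. \<exists>S. finite S \<and> S \<subseteq> dyadic \<and> (\<forall>x\<in>B - S. locally_affine2 g x)"
    using pl by (auto simp: pl2_bij_def)
  then obtain S where S: "\<And>B. B \<in> \<B> \<Longrightarrow> finite (S B) \<and> S B \<subseteq> dyadic \<and> (\<forall>x\<in>B - S B. locally_affine2 g x)"
    by metis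
  have "\<exists>S. finite S \<and> S \<subseteq> dyadic \<and> (\<forall>x \<in> U - S. locally_affine2 g x)"
    using S fin dy by (intro exI[of _ "(U - \<Union>\<B>) \<union> (\<Union>B\<in>\<B>. S B)"]) blast
  moreover have "g x \<in> dyadic \<longleftrightarrow> x \<in> dyadic" if "x \<in> U" for x
    using that id pl2_bij_dyadic[OF pl] by (cases "x \<in> \<Union>\<B>") auto
  ultimately show ?thesis
    using mono im strict_mono_on_imp_inj_on[OF mono] by (auto simp: pl2_bij_def bij_betw_def)
qed

section \<open>One-sided affine germs and the values they force\<close>

lemma affine_unique_at_right:
  fixes x :: real
  assumes "\<forall>\<^sub>F y in at_right x. k * y + b = l * y + c"
  shows "k = l" "b = c"
proof -
  obtain e where e: "e > x" "\<And>y. y > x \<Longrightarrow> y < e \<Longrightarrow> k * y + b = l * y + c"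
    using assms by (auto simp: eventually_at_right_field)
  define y where "y = (x + e) / 2"
  define z where "z = (x + y) / 2"
  have y: "x < y" "y < e" using e(1) by (auto simp: y_def)
  then have "x < z" "z < y" by (auto simp: z_def)
  with y have "k * y + b = l * y + c" "k * z + b = l * z + c" "z < y"
    using e(2)[of y] e(2)[of z] by auto
  then have "(k - l) * (y - z) = 0" "z < y" by (auto simp: algebra_simps)
  then show "k = l" by auto
  with \<open>k * y + b = l * y + c\<close> show "b = c" by simp
qed

lemma affine_unique_at_left:
  fixes x :: real
  assumes "\<forall>\<^sub>F y in at_left x. k * y + b = l * y + c"
  shows "k = l" "b = c"
proof -
  have "\<forall>\<^sub>F y in at_right (- x). (- k) * y + b = (- l) * y + c"
    using assms by (simp add: at_left_minus eventually_filtermap)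
  from affine_unique_at_right[OF this] show "k = l" "b = c" by auto
qed

text \<open>The pair of slope and intercept, read off through \<open>deriv\<close>, is locally
  constant and hence constant on the connected interval. The iterated neighbourhood statement
  appears because the derivative at a nearby point depends on a neighbourhood of that point.\<close>

lemma affine_on_interval:
  assumes "\<And>x. x \<in> {u<..<v} \<Longrightarrow> locally_affine2 f x"
  shows "\<exists>(k::int) b. \<forall>x\<in>{u<..<v}. f x = 2 powi k * x + b"
proof (cases "u < v")
  case True
  define g where "g y = (deriv f y, f y - deriv f y * y)" for y
  have loc: "\<exists>(k::int) b. \<forall>\<^sub>F y in nhds x. g y = (2 powi k, b)" if x: "x \<in> {u<..<v}" for x
  proof -
    obtain k b where "\<forall>\<^sub>F y in nhds x. f y = 2 powi k * y + b"
      using assms[OF x] by (auto simp: locally_affine2_def)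
    then have "\<forall>\<^sub>F y in nhds x. \<forall>\<^sub>F z in nhds y. f z = 2 powi k * z + b"
      by (simp add: eventually_eventually)
    then have "\<forall>\<^sub>F y in nhds x. g y = (2 powi k, b)"
    proof eventually_elim
      case (elim y)
      have "((\<lambda>z. 2 powi k * z + b) has_real_derivative 2 powi k) (at y)"
        by (auto intro!: derivative_eq_intros)
      then have "(f has_real_derivative 2 powi k) (at y)"
        using DERIV_cong_ev[OF refl elim refl] by simp
      then have "deriv f y = 2 powi k" by (rule DERIV_imp_deriv)
      moreover have "f y = 2 powi k * y + b" using eventually_nhds_x_imp_x[OF elim] .
      ultimately show ?case by (simp add: g_def)
    qed
    then show ?thesis by blast
  qed
  define m where "m = (u + v) / 2"
  have m: "m \<in> {u<..<v}" using True by (auto simp: m_def)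
  obtain k b where kb: "g m = (2 powi k, b)"
    using loc[OF m] eventually_nhds_x_imp_x by blast
  have "g x = g m" if x: "x \<in> {u<..<v}" for x
  proof (rule connected_local_const[OF _ x m])
    show "\<forall>x\<in>{u<..<v}. \<forall>\<^sub>F y in at x within {u<..<v}. g x = g y"
    proof
      fix x assume "x \<in> {u<..<v}"
      then obtain k b where *: "\<forall>\<^sub>F y in nhds x. g y = (2 powi k, b)" using loc by blast
      then have "\<forall>\<^sub>F y in nhds x. g x = g y"
        by (rule eventually_mono) (simp add: eventually_nhds_x_imp_x[OF *])
      then show "\<forall>\<^sub>F y in at x within {u<..<v}. g x = g y"
        unfolding eventually_at_filter by (rule eventually_mono) simp
    qed
  qed simp
  then have "f x = 2 powi k * x + b" if "x \<in> {u<..<v}" for x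
    using that kb by (fastforce simp: g_def)
  then show ?thesis by blast
qed auto

text \<open>Finitely many exceptions cannot accumulate at u, so f is affine up to the nearest one on
  the right, or up to v. The point u may itself be a break or an end of the domain.\<close>

lemma right_germ_affine:
  assumes "finite S" "u < v" "\<And>x. x \<in> {u<..<v} - S \<Longrightarrow> locally_affine2 f x"
  shows "\<exists>(k::int) b. \<forall>\<^sub>F y in at_right u. f y = 2 powi k * y + b"
proof -
  define w where "w = Min (insert v {s \<in> S. s > u})"
  have fin: "finite (insert v {s \<in> S. s > u})" using assms by simp
  have "w \<in> insert v {s \<in> S. s > u}" unfolding w_def by (rule Min_in[OF fin]) simp
  then have "w > u" using assms(2) by auto
  have le: "w \<le> s" if "s \<in> insert v {s \<in> S. s > u}" for s
    unfolding w_def using fin that by simp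
  have "locally_affine2 f x" if "x \<in> {u<..<w}" for x
    using that le[of x] le[of v] by (intro assms(3)) auto
  then obtain k b where "\<forall>x\<in>{u<..<w}. f x = 2 powi k * x + b"
    using affine_on_interval by blast
  then show ?thesis
    using \<open>w > u\<close> by (intro exI[of _ k] exI[of _ b]) (auto simp: eventually_at_right_field)
qed

lemma left_germ_affine:
  assumes "finite S" "u < v" "\<And>x. x \<in> {u<..<v} - S \<Longrightarrow> locally_affine2 f x"
  shows "\<exists>(k::int) b. \<forall>\<^sub>F y in at_left v. f y = 2 powi k * y + b"
proof -
  define w where "w = Max (insert u {s \<in> S. s < v})"
  have fin: "finite (insert u {s \<in> S. s < v})" using assms by simp
  have "w \<in> insert u {s \<in> S. s < v}" unfolding w_def by (rule Max_in[OF fin]) simp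
  then have "w < v" using assms(2) by auto
  have le: "s \<le> w" if "s \<in> insert u {s \<in> S. s < v}" for s
    unfolding w_def using fin that by simp
  have "locally_affine2 f x" if "x \<in> {w<..<v}" for x
    using that le[of x] le[of u] by (intro assms(3)) auto
  then obtain k b where "\<forall>x\<in>{w<..<v}. f x = 2 powi k * x + b"
    using affine_on_interval by blast
  then show ?thesis
    using \<open>w < v\<close> by (intro exI[of _ k] exI[of _ b]) (auto simp: eventually_at_left_field)
qed

lemma strict_mono_bij_continuous_on:
  fixes f :: "real \<Rightarrow> real"
  assumes "bij_betw f A B" "strict_mono_on A f" "open B"
  shows "continuous_on A f"
  using assms by (intro continuous_onI_mono) (auto simp: bij_betw_def intro: strict_mono_on_leD)

lemma strict_mono_bij_tendsto_left_end:
  fixes f :: "real \<Rightarrow> real"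
  assumes bij: "bij_betw f {a<..<b} {c<..<d}" and mono: "strict_mono_on {a<..<b} f" and "a < b"
  shows "(f \<longlongrightarrow> c) (at_right a)"
proof (rule order_tendstoI)
  have inside: "\<forall>\<^sub>F y in at_right a. y \<in> {a<..<b}"
    using \<open>a < b\<close> by (auto simp: eventually_at_right_field)
  fix l assume "l < c"
  then show "\<forall>\<^sub>F y in at_right a. l < f y"
    using inside bij_betwE[OF bij] by (auto elim!: eventually_mono) force
next
  fix u assume u: "c < u"
  have "f ((a + b) / 2) \<in> {c<..<d}" using bij_betwE[OF bij] \<open>a < b\<close> by auto
  then have "c < d" by auto
  then obtain w where w: "c < w" "w < min u d" using u dense[of c "min u d"] by auto
  then have "w \<in> f ` {a<..<b}" using bij by (simp add: bij_betw_def)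
  then obtain z where z: "z \<in> {a<..<b}" "f z = w" by blast
  have "f y < u" if "a < y" "y < z" for y
    using strict_mono_onD[OF mono, of y z] that z w by auto
  then show "\<forall>\<^sub>F y in at_right a. f y < u"
    using z by (auto simp: eventually_at_right_field)
qed

text \<open>The end-point lies outside the interval, so a limit replaces the value there:
  monotonicity and surjectivity make it c. This fixes the intercept once the slope is known.\<close>

lemma strict_mono_bij_right_germ:
  fixes f :: "real \<Rightarrow> real"
  assumes bij: "bij_betw f {a<..<b} {c<..<d}" and mono: "strict_mono_on {a<..<b} f" and "a < b"
    and germ: "\<forall>\<^sub>F y in at_right a. f y = k * y + e"
  shows "k * a + e = c"
proof -
  have "((\<lambda>y. k * y + e) \<longlongrightarrow> k * a + e) (at_right a)"
    by (intro tendsto_intros)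
  then have "(f \<longlongrightarrow> k * a + e) (at_right a)"
    by (rule Lim_transform_eventually) (use germ in \<open>auto elim: eventually_mono\<close>)
  then show ?thesis
    using strict_mono_bij_tendsto_left_end[OF bij mono \<open>a < b\<close>] tendsto_unique trivial_limit_at_right_real
    by blast
qed

lemma isCont_germs:
  fixes f :: "real \<Rightarrow> real"
  assumes "isCont f x"
  shows "\<forall>\<^sub>F y in at_right x. f y = k * y + b \<Longrightarrow> f x = k * x + b"
    and "\<forall>\<^sub>F y in at_left x. f y = k * y + b \<Longrightarrow> f x = k * x + b"
proof -
  have lim: "(f \<longlongrightarrow> f x) (at x within S)" for S
    using assms by (auto simp: continuous_within intro: tendsto_within_subset)
  have *: "f x = k * x + b" if "\<forall>\<^sub>F y in at x within S. f y = k * y + b" "at x within S \<noteq> bot" for S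
  proof -
    have "((\<lambda>y. k * y + b) \<longlongrightarrow> k * x + b) (at x within S)"
      by (intro tendsto_intros)
    then have "(f \<longlongrightarrow> k * x + b) (at x within S)"
      by (rule Lim_transform_eventually) (use that in \<open>auto elim: eventually_mono\<close>)
    then show ?thesis using lim[of S] that(2) tendsto_unique by blast
  qed
  show "f x = k * x + b" if "\<forall>\<^sub>F y in at_right x. f y = k * y + b"
    by (rule *[OF that]) simp
  show "f x = k * x + b" if "\<forall>\<^sub>F y in at_left x. f y = k * y + b"
    by (rule *[OF that]) simp
qed

text \<open>Whether the intercept of the affine germ to the right of a point is dyadic is a locally constant
  property: this is clear away from the nodes, and at a node the point itself is dyadic.\<close>

lemma dyadic_preserved:
  assumes bij: "bij_betw f {0<..<1} {0<..<1::real}" and mono: "strict_mono_on {0<..<1} f"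
    and S: "finite S" "S \<subseteq> dyadic" and aff: "\<And>x. x \<in> {0<..<1} - S \<Longrightarrow> locally_affine2 f x"
    and x: "x \<in> {0<..<1}"
  shows "f x \<in> dyadic \<longleftrightarrow> x \<in> dyadic"
proof -
  define Q where "Q x \<longleftrightarrow> (\<exists>(k::int) b. b \<in> dyadic \<and> (\<forall>\<^sub>F y in at_right x. f y = 2 powi k * y + b))" for x
  have Q_iff: "Q x \<longleftrightarrow> b \<in> dyadic" if germ: "\<forall>\<^sub>F y in at_right x. f y = 2 powi k * y + b" for x b and k :: int
  proof
    assume "Q x"
    then obtain l c where "c \<in> dyadic" and l: "\<forall>\<^sub>F y in at_right x. f y = 2 powi (l::int) * y + c"
      unfolding Q_def by blast
    from germ l have "\<forall>\<^sub>F y in at_right x. 2 powi k * y + b = 2 powi l * y + c"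
      by eventually_elim simp
    then show "b \<in> dyadic" using affine_unique_at_right(2) \<open>c \<in> dyadic\<close> by blast
  qed (use germ in \<open>auto simp: Q_def\<close>)
  have Q_iff_Ioo: "Q y \<longleftrightarrow> b \<in> dyadic"
    if "\<forall>z\<in>{u<..<v}. f z = 2 powi k * z + b" "y \<in> {u<..<v}" for y u v b and k :: int
    using that by (intro Q_iff[of k]) (auto simp: eventually_at_right_field)
  have cont: "isCont f x" if "x \<in> {0<..<1}" for x
    using continuous_on_eq_continuous_at[of "{0<..<1}" f] that
      strict_mono_bij_continuous_on[OF bij mono] by auto
  have right: "\<exists>(k::int) b. \<forall>\<^sub>F y in at_right x. f y = 2 powi k * y + b" if "x \<in> {0..<1}" for x
    using aff that by (intro right_germ_affine[OF S(1), of x 1]) auto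
  have left: "\<exists>(k::int) b. \<forall>\<^sub>F y in at_left x. f y = 2 powi k * y + b" if "x \<in> {0<..<1}" for x
    using aff that by (intro left_germ_affine[OF S(1), of 0]) auto
  have local: "\<forall>\<^sub>F y in at x within {0..<1}. Q x = Q y" if x: "x \<in> {0..<1}" for x
  proof -
    obtain k b where kb: "\<forall>\<^sub>F y in at_right x. f y = 2 powi (k::int) * y + b"
      using right[OF x] by blast
    then obtain e where e: "e > x" "\<forall>y\<in>{x<..<e}. f y = 2 powi k * y + b"
      by (auto simp: eventually_at_right_field)
    have "\<forall>\<^sub>F y in at_right x. y \<in> {0..<1} \<longrightarrow> Q x = Q y"
      using Q_iff[OF kb] Q_iff_Ioo[OF e(2)] e(1) by (auto simp: eventually_at_right_field)
    moreover have "\<forall>\<^sub>F y in at_left x. y \<in> {0..<1} \<longrightarrow> Q x = Q y"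
    proof (cases "x = 0")
      \<comment> \<open>At 0 the half-open interval has no points on the left, so the condition is
        vacuous.\<close>
      case True
      then show ?thesis by (auto simp: eventually_at_left_field intro!: exI[of _ "-1"])
    next
      case False
      then have x': "x \<in> {0<..<1}" using x by auto
      obtain l c where lc: "\<forall>\<^sub>F y in at_left x. f y = 2 powi (l::int) * y + c"
        using left[OF x'] by blast
      then obtain e' where e': "e' < x" "\<forall>y\<in>{e'<..<x}. f y = 2 powi l * y + c"
        by (auto simp: eventually_at_left_field)
      have fx: "f x = 2 powi k * x + b" "f x = 2 powi l * x + c"
        using isCont_germs[OF cont[OF x']] kb lc by blast+
      have "b \<in> dyadic \<longleftrightarrow> c \<in> dyadic"
      proof (cases "x \<in> S")
        case True
        then have "2 powi k * x \<in> dyadic" "2 powi l * x \<in> dyadic" using S(2) by auto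
        then have "f x \<in> dyadic \<longleftrightarrow> b \<in> dyadic" "f x \<in> dyadic \<longleftrightarrow> c \<in> dyadic"
          using fx by (metis add.commute dyadic_add_iff)+
        then show ?thesis by simp
      next
        case False
        then have "locally_affine2 f x" using aff x' by blast
        then obtain j d where *: "\<forall>\<^sub>F y in nhds x. f y = 2 powi (j::int) * y + d"
          unfolding locally_affine2_def by blast
        have "\<forall>\<^sub>F y in at_right x. f y = 2 powi j * y + d" "\<forall>\<^sub>F y in at_left x. f y = 2 powi j * y + d"
          using * by (auto simp: eventually_at_filter elim: eventually_mono)
        with kb lc have "\<forall>\<^sub>F y in at_right x. 2 powi k * y + b = 2 powi j * y + d"
          "\<forall>\<^sub>F y in at_left x. 2 powi l * y + c = 2 powi j * y + d"
          by (auto elim: eventually_elim2)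
        then show ?thesis using affine_unique_at_right(2) affine_unique_at_left(2) by metis
      qed
      then show ?thesis
        using Q_iff[OF kb] Q_iff_Ioo[OF e'(2)] e'(1) by (auto simp: eventually_at_left_field)
    qed
    ultimately have "\<forall>\<^sub>F y in at x. y \<in> {0..<1} \<longrightarrow> Q x = Q y"
      by (simp add: eventually_at_split)
    then show ?thesis unfolding eventually_at_filter by (rule eventually_mono) auto
  qed
  \<comment> \<open>Here the propagation starts: f tends to 0 at 0, so the first germ has intercept
    0.\<close>
  have "Q 0"
  proof -
    obtain k b where kb: "\<forall>\<^sub>F y in at_right 0. f y = 2 powi (k::int) * y + b"
      using right[of 0] by auto
    then have "b = 0" using strict_mono_bij_right_germ[OF bij mono _ kb] by simp
    then show ?thesis using Q_iff[OF kb] by simp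
  qed
  moreover have "Q 0 = Q x"
    by (rule connected_local_const[of "{0..<1}"]) (use local x in auto)
  ultimately obtain k b where b: "b \<in> dyadic" "\<forall>\<^sub>F y in at_right x. f y = 2 powi (k::int) * y + b"
    unfolding Q_def by blast
  have "f x = 2 powi k * x + b" using isCont_germs(1)[OF cont[OF x] b(2)] .
  then show ?thesis using dyadic_add_iff[OF b(1)] by simp
qed

section \<open>Thompson's group in terms of \<open>pl2_bij\<close>\<close>

lemma Thompson_F_BijGroup: "Thompson_F = BijGroup {0<..<1} \<lparr>carrier := carrier Thompson_F\<rparr>"
  by (simp add: Thompson_F_def PL_plus_def)

text \<open>After this translation \<open>nodes\<close> and derivatives are no longer mentioned. The
  definition yields every clause of \<open>pl2_bij\<close> except the one on dyadic values, which is
  \<open>dyadic_preserved\<close>. On the way back, continuity of the inverse is that of an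
  increasing bijection, applied to \<open>inv_into\<close>.\<close>

lemma Thompson_F_iff:
  "f \<in> carrier Thompson_F \<longleftrightarrow> f \<in> extensional {0<..<1} \<and> pl2_bij {0<..<1} {0<..<1} f"
proof
  assume f: "f \<in> carrier Thompson_F"
  then obtain h where ext: "f \<in> extensional {0<..<1}" and h: "homeomorphism {0<..<1} {0<..<1} f h"
    and mono: "mono_on {0<..<1} f" and nodes: "finite (nodes f)" "nodes f \<subseteq> dyadic"
    and der: "\<And>x. x \<in> {0<..<1} - nodes f \<Longrightarrow> \<exists>k::int. (f has_real_derivative 2 powi k) (at x)"
    by (auto simp: Thompson_F_def PL_plus_def)
  have bij: "bij_betw f {0<..<1} {0<..<1}"
    using h by (auto simp: homeomorphism_def intro!: bij_betw_byWitness[where f' = h])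
  have smono: "strict_mono_on {0<..<1} f"
  proof (rule strict_mono_onI)
    fix x y :: real assume xy: "x \<in> {0<..<1}" "y \<in> {0<..<1}" "x < y"
    then have "f x \<le> f y" "f x \<noteq> f y"
      using mono_onD[OF mono, of x y] bij by (auto simp: bij_betw_def inj_on_eq_iff)
    then show "f x < f y" by simp
  qed
  have aff: "locally_affine2 f x" if x: "x \<in> {0<..<1} - nodes f" for x
  proof -
    obtain a b where ab: "\<forall>\<^sub>F y in nhds x. f y = a * y + b" using x by (auto simp: nodes_def)
    obtain k where k: "(f has_real_derivative 2 powi (k::int)) (at x)" using der[OF x] by blast
    have "((\<lambda>y. a * y + b) has_real_derivative a) (at x)" by (auto intro!: derivative_eq_intros)
    then have "(f has_real_derivative a) (at x)" using DERIV_cong_ev[OF refl ab refl] by simp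
    then have "a = 2 powi k" using k DERIV_unique by blast
    then show ?thesis using ab by (auto simp: locally_affine2_def)
  qed
  show "f \<in> extensional {0<..<1} \<and> pl2_bij {0<..<1} {0<..<1} f"
    using ext bij smono aff nodes dyadic_preserved[OF bij smono nodes aff]
    by (auto simp: pl2_bij_def intro!: exI[of _ "nodes f"])
next
  assume "f \<in> extensional {0<..<1} \<and> pl2_bij {0<..<1} {0<..<1} f"
  then have ext: "f \<in> extensional {0<..<1}" and pl: "pl2_bij {0<..<1} {0<..<1} f" by auto
  let ?h = "inv_into {0<..<1} f"
  have pl': "pl2_bij {0<..<1} {0<..<1} ?h" by (rule pl2_bij_inv_into[OF pl]) simp
  have "homeomorphism {0<..<1} {0<..<1} f ?h"
    unfolding homeomorphism_def
    using strict_mono_bij_continuous_on[OF pl2_bij_betw[OF pl] pl2_bij_mono[OF pl]]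
      strict_mono_bij_continuous_on[OF pl2_bij_betw[OF pl'] pl2_bij_mono[OF pl']]
      pl2_bij_image[OF pl] pl2_bij_image[OF pl'] pl2_bij_inj[OF pl]
    by (auto simp: f_inv_into_f)
  moreover have "mono_on {0<..<1} f"
    using pl2_bij_mono[OF pl] by (rule strict_mono_on_imp_mono_on)
  moreover obtain S where S: "finite S" "S \<subseteq> dyadic" "\<And>x. x \<in> {0<..<1} - S \<Longrightarrow> locally_affine2 f x"
    using pl by (auto simp: pl2_bij_def)
  have nodes: "nodes f \<subseteq> S"
    using S(3) by (fastforce simp: nodes_def locally_affine2_def)
  \<comment> \<open>The point x may belong to S without being a node; its slope is then identified
    with that of the affine germ on the right, which is a power of two.\<close>
  moreover have "\<exists>k::int. (f has_real_derivative 2 powi k) (at x)" if x: "x \<in> {0<..<1} - nodes f" for x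
  proof -
    obtain a b where ab: "\<forall>\<^sub>F y in nhds x. f y = a * y + b" using x by (auto simp: nodes_def)
    then have ab': "\<forall>\<^sub>F y in at_right x. f y = a * y + b"
      by (auto simp: eventually_at_filter elim: eventually_mono)
    obtain k c where "\<forall>\<^sub>F y in at_right x. f y = 2 powi (k::int) * y + c"
      using right_germ_affine[OF S(1), of x 1 f] S(3) x by auto
    with ab' have "\<forall>\<^sub>F y in at_right x. a * y + b = 2 powi k * y + c"
      by eventually_elim simp
    then have "a = 2 powi k" by (rule affine_unique_at_right(1))
    moreover have "((\<lambda>y. a * y + b) has_real_derivative a) (at x)" by (auto intro!: derivative_eq_intros)
    ultimately show ?thesis using DERIV_cong_ev[OF refl ab refl] by auto
  qed
  ultimately show "f \<in> carrier Thompson_F"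
    using ext S finite_subset[OF nodes] by (auto simp: Thompson_F_def PL_plus_def)
qed

lemma Thompson_F_pl2_bij: "f \<in> carrier Thompson_F \<Longrightarrow> pl2_bij {0<..<1} {0<..<1} f"
  by (simp add: Thompson_F_iff)

lemma restrict_in_Thompson_F:
  "pl2_bij {0<..<1} {0<..<1} f \<Longrightarrow> restrict f {0<..<1} \<in> carrier Thompson_F"
  by (auto simp: Thompson_F_iff intro: pl2_bij_cong[where f = f])

lemma Thompson_F_eqI:
  assumes "f \<in> carrier Thompson_F" "g \<in> carrier Thompson_F" "\<And>x. x \<in> {0<..<1} \<Longrightarrow> f x = g x"
  shows "f = g"
  using assms by (auto simp: Thompson_F_iff intro: extensionalityI)

lemma Thompson_F_subset_Bij: "carrier Thompson_F \<subseteq> Bij {0<..<1}"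
  by (auto simp: Thompson_F_iff Bij_def pl2_bij_betw)

lemma Thompson_F_mult:
  assumes "g \<in> carrier Thompson_F" "f \<in> carrier Thompson_F"
  shows "g \<otimes>\<^bsub>Thompson_F\<^esub> f = compose {0<..<1} g f"
  using assms Thompson_F_subset_Bij
  by (subst Thompson_F_BijGroup) (auto simp: BijGroup_def)

lemma Thompson_F_one: "\<one>\<^bsub>Thompson_F\<^esub> = restrict (\<lambda>x. x) {0<..<1}"
  by (subst Thompson_F_BijGroup) (simp add: BijGroup_def)

lemma group_Thompson_F: "group Thompson_F"
proof -
  interpret B: group "BijGroup {0<..<1::real}" by (rule group_BijGroup)
  have "subgroup (carrier Thompson_F) (BijGroup {0<..<1})"
  proof (rule B.subgroupI)
    show "carrier Thompson_F \<subseteq> carrier (BijGroup {0<..<1})"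
      using Thompson_F_subset_Bij by (simp add: BijGroup_def)
    have "restrict (\<lambda>x. x) {0<..<1} \<in> carrier Thompson_F"
      by (rule restrict_in_Thompson_F[OF pl2_bij_id])
    then show "carrier Thompson_F \<noteq> {}" by blast
  next
    fix f assume f: "f \<in> carrier Thompson_F"
    then have "restrict (inv_into {0<..<1} f) {0<..<1} \<in> carrier Thompson_F"
      by (intro restrict_in_Thompson_F pl2_bij_inv_into Thompson_F_pl2_bij) simp_all
    then show "inv\<^bsub>BijGroup {0<..<1}\<^esub> f \<in> carrier Thompson_F"
      using f Thompson_F_subset_Bij by (auto simp: inv_BijGroup)
  next
    fix f g assume fg: "f \<in> carrier Thompson_F" "g \<in> carrier Thompson_F"
    then have "compose {0<..<1} f g \<in> carrier Thompson_F"
      using restrict_in_Thompson_F[OF pl2_bij_comp[OF Thompson_F_pl2_bij Thompson_F_pl2_bij], of g f]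
      by (simp add: compose_def comp_def)
    then show "f \<otimes>\<^bsub>BijGroup {0<..<1}\<^esub> g \<in> carrier Thompson_F"
      using fg Thompson_F_subset_Bij by (auto simp: BijGroup_def)
  qed
  then have "group (BijGroup {0<..<1} \<lparr>carrier := carrier Thompson_F\<rparr>)"
    by (rule subgroup.subgroup_is_group[OF _ group_BijGroup])
  then show ?thesis by (subst Thompson_F_BijGroup)
qed

section \<open>Complementary intervals of finite sets\<close>

text \<open>For finite P with 0 and 1 in P and P inside [0,1] these are the components of (0,1)
  minus P (\<open>components_diff_finite\<close>). The explicit form keeps the end-points at
  hand.\<close>

definition gaps :: "real set \<Rightarrow> real set set" where
  "gaps P = {{a<..<b} | a b. a \<in> P \<and> b \<in> P \<and> a < b \<and> P \<inter> {a<..<b} = {}}"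

lemma gapsE:
  assumes "B \<in> gaps P"
  obtains a b where "B = {a<..<b}" "a \<in> P" "b \<in> P" "a < b" "P \<inter> {a<..<b} = {}"
  using assms unfolding gaps_def by blast

lemma gaps_properties:
  assumes "B \<in> gaps P"
  shows gaps_open: "open B" and gaps_interval: "is_interval B" and gaps_connected: "connected B"
    and gaps_nonempty: "B \<noteq> {}" and gaps_disjoint_points: "P \<inter> B = {}"
  using assms by (auto elim!: gapsE simp: is_interval_oo)

lemma Ioo_eq_iff:
  fixes a b c d :: real
  assumes "a < b" "{a<..<b} = {c<..<d}"
  shows "a = c" "b = d"
proof -
  have "c < d" using assms by (metis greaterThanLessThan_empty_iff not_le)
  then show "a = c" "b = d"
    using assms by (metis cInf_greaterThanLessThan, metis cSup_greaterThanLessThan)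
qed

lemma gaps_eqI:
  assumes "B \<in> gaps P" "B' \<in> gaps P" "x \<in> B" "x \<in> B'"
  shows "B = B'"
proof -
  obtain a b where B: "B = {a<..<b}" "a \<in> P" "b \<in> P" "a < b" "P \<inter> {a<..<b} = {}"
    using assms(1) by (rule gapsE)
  obtain c d where B': "B' = {c<..<d}" "c \<in> P" "d \<in> P" "c < d" "P \<inter> {c<..<d} = {}"
    using assms(2) by (rule gapsE)
  have "a \<notin> {c<..<d}" "b \<notin> {c<..<d}" "c \<notin> {a<..<b}" "d \<notin> {a<..<b}" using B B' by auto
  then have "a = c" "b = d" using assms(3,4) B(1) B'(1) by auto
  then show ?thesis using B B' by simp
qed

lemma disjnt_gaps: "pairwise disjnt (gaps P)"
  using gaps_eqI by (fastforce simp: pairwise_def disjnt_def)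

lemma finite_gaps: "finite P \<Longrightarrow> finite (gaps P)"
  by (rule finite_subset[of _ "(\<lambda>(a, b). {a<..<b}) ` (P \<times> P)"]) (auto simp: gaps_def)

lemma gaps_cover:
  assumes "finite P" "x \<notin> P" "u \<in> P" "u < x" "v \<in> P" "x < v"
  shows "\<exists>B\<in>gaps P. x \<in> B"
proof -
  define a where "a = Max {p \<in> P. p < x}"
  define b where "b = Min {p \<in> P. x < p}"
  have "a \<in> {p \<in> P. p < x}" unfolding a_def by (rule Max_in) (use assms in auto)
  moreover have "b \<in> {p \<in> P. x < p}" unfolding b_def by (rule Min_in) (use assms in auto)
  moreover have "p \<le> a" if "p \<in> P" "p < x" for p unfolding a_def using assms that by simp
  moreover have "b \<le> p" if "p \<in> P" "x < p" for p unfolding b_def using assms that by simp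
  ultimately have ab: "a \<in> P" "a < x" "b \<in> P" "x < b"
    and "\<And>p. p \<in> P \<Longrightarrow> p < x \<Longrightarrow> p \<le> a" "\<And>p. p \<in> P \<Longrightarrow> x < p \<Longrightarrow> b \<le> p" by auto
  then have "P \<inter> {a<..<b} = {}"
    using assms(2) by (metis disjoint_iff greaterThanLessThan_iff linorder_neqE_linordered_idom not_le)
  then have "{a<..<b} \<in> gaps P" using ab unfolding gaps_def by force
  moreover have "x \<in> {a<..<b}" using ab by simp
  ultimately show ?thesis ..
qed

lemma Union_gaps:
  assumes "finite P" "{0, 1} \<subseteq> P" "P \<subseteq> {0..1}"
  shows "\<Union>(gaps P) = {0<..<1} - P"
proof
  show "\<Union>(gaps P) \<subseteq> {0<..<1} - P"
    using assms(3) by (fastforce elim!: gapsE)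
  show "{0<..<1} - P \<subseteq> \<Union>(gaps P)"
    using gaps_cover[OF assms(1), of _ 0 1] assms(2) by auto
qed

text \<open>Equal gaps have equal unions, which determines the points inside (0,1); the rest is {0,
  1} on both sides. This turns the clause of \<open>division\<close> about components into one about
  points.\<close>

lemma gaps_inject:
  assumes "finite P" "{0, 1} \<subseteq> P" "P \<subseteq> {0..1}" "finite Q" "{0, 1} \<subseteq> Q" "Q \<subseteq> {0..1}" "gaps P = gaps Q"
  shows "P = Q"
proof -
  have eq: "{0<..<1} - P = {0<..<1} - Q" using Union_gaps assms by metis
  have "x \<in> P \<longleftrightarrow> x \<in> Q" for x
  proof (cases "x \<in> {0<..<1}")
    case True
    then show ?thesis using eq by blast
  next
    case False
    have "x \<in> P \<longleftrightarrow> x = 0 \<or> x = 1" "x \<in> Q \<longleftrightarrow> x = 0 \<or> x = 1"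
      using assms(2,3,5,6) False by force+
    then show ?thesis by simp
  qed
  then show ?thesis by blast
qed

text \<open>A connected set that contains the interval and one more point would also contain a or
  b.\<close>

lemma Ioo_in_components:
  fixes a b :: real
  assumes "a < b" "{a<..<b} \<subseteq> X" "a \<notin> X" "b \<notin> X"
  shows "{a<..<b} \<in> components X"
  unfolding in_components_maximal
proof (intro conjI allI impI)
  fix D assume D: "D \<noteq> {} \<and> {a<..<b} \<subseteq> D \<and> D \<subseteq> X \<and> connected D"
  define m where "m = (a + b) / 2"
  have m: "a < m" "m < b" using assms(1) by (auto simp: m_def)
  then have "m \<in> D" using D by auto
  have "x \<in> {a<..<b}" if x: "x \<in> D" for x
  proof (rule ccontr)
    assume "x \<notin> {a<..<b}"
    then have "a \<in> D \<or> b \<in> D"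
      using connectedD_interval[of D x m a] connectedD_interval[of D m x b] D x m \<open>m \<in> D\<close> by force
    then show False using D assms by auto
  qed
  then show "D = {a<..<b}" using D by auto
qed (use assms in auto)

lemma components_diff_finite:
  assumes "finite P" "{0, 1} \<subseteq> P" "P \<subseteq> {0..1}"
  shows "components ({0<..<1} - P) = gaps P"
proof -
  have sub: "gaps P \<subseteq> components ({0<..<1} - P)"
  proof
    fix B assume B: "B \<in> gaps P"
    then obtain a b where "B = {a<..<b}" "a \<in> P" "b \<in> P" "a < b" by (rule gapsE)
    then show "B \<in> components ({0<..<1} - P)"
      using Union_gaps[OF assms] B by (auto intro!: Ioo_in_components)
  qed
  moreover have "C \<in> gaps P" if C: "C \<in> components ({0<..<1} - P)" for C
  proof -
    obtain x where x: "x \<in> C" using in_components_nonempty[OF C] by blast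
    then have "x \<in> \<Union>(gaps P)" using in_components_subset[OF C] Union_gaps[OF assms] by blast
    then obtain B where B: "B \<in> gaps P" "x \<in> B" by blast
    then have "C = B" using components_eq[OF C, of B] sub x by blast
    then show ?thesis using B by simp
  qed
  ultimately show ?thesis by blast
qed

section \<open>Increasing enumerations of finite sets of reals\<close>

lemma strict_mono_on_enumeration:
  assumes "finite (P :: real set)" "P \<noteq> {}"
  shows "\<exists>m p. strict_mono_on {0..m} p \<and> p ` {0..m::nat} = P"
proof -
  let ?xs = "sorted_list_of_set P"
  define m where "m = length ?xs - 1"
  have len: "length ?xs = Suc m" using assms by (simp add: m_def card_gt_0_iff)
  have "strict_mono_on {0..m} ((!) ?xs)"
    using sorted_wrt_nth_less[OF strict_sorted_list_of_set[of P]] len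
    by (auto intro!: strict_mono_onI)
  moreover have "(!) ?xs ` {0..m} = P"
  proof -
    have "{0..m} = {..<length ?xs}" using len by auto
    then have "(!) ?xs ` {0..m} = set ?xs" by (auto simp: set_conv_nth)
    then show ?thesis using assms by simp
  qed
  ultimately show ?thesis by blast
qed

text \<open>Both enumerations, written as lists, are the sorted list of their common image.\<close>

lemma strict_mono_on_enumeration_unique:
  fixes p q :: "nat \<Rightarrow> real"
  assumes "strict_mono_on {0..m} p" "strict_mono_on {0..n} q" "p ` {0..m} = q ` {0..n}"
  shows "m = n" "\<And>j. j \<le> m \<Longrightarrow> p j = q j"
proof -
  have list: "map r [0..<Suc k] = sorted_list_of_set (r ` {0..k})" if "strict_mono_on {0..k} r" for r :: "nat \<Rightarrow> real" and k
  proof -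
    have "sorted_wrt (<) (map r [0..<Suc k])"
      unfolding sorted_wrt_map
      by (rule sorted_wrt_mono_rel[OF _ sorted_wrt_upt]) (use strict_mono_onD[OF that] in auto)
    moreover have "set (map r [0..<Suc k]) = r ` {0..k}"
      by (auto simp: atLeastLessThanSuc_atLeastAtMost simp del: upt_Suc)
    ultimately show ?thesis
      by (intro strict_sorted_equal) (auto simp del: upt_Suc)
  qed
  have eq: "map p [0..<Suc m] = map q [0..<Suc n]" using list assms by metis
  then have "length (map p [0..<Suc m]) = length (map q [0..<Suc n])" by (rule arg_cong)
  then show "m = n" by simp
  then show "p j = q j" if "j \<le> m" for j
    using eq that by (simp del: upt_Suc)
qed

lemma gaps_enumeration:
  assumes p: "strict_mono_on {0..m::nat} p"
  shows "gaps (p ` {0..m}) = (\<lambda>j. {p (j - 1)<..<p j}) ` {1..m}"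
proof -
  have less: "p i < p j \<longleftrightarrow> i < j" if "i \<le> m" "j \<le> m" for i j
    using strict_mono_onD[OF p, of i j] strict_mono_on_leD[OF p, of j i] that by (cases "i < j") auto
  show ?thesis
  proof (intro subset_antisym subsetI)
    fix B assume "B \<in> gaps (p ` {0..m})"
    then obtain a b where B: "B = {a<..<b}" "a \<in> p ` {0..m}" "b \<in> p ` {0..m}" "a < b"
      "p ` {0..m} \<inter> {a<..<b} = {}" by (rule gapsE)
    then obtain i j where ij: "a = p i" "b = p j" "i \<le> m" "j \<le> m" by auto
    then have "i < j" using B less by auto
    have "\<not> Suc i < j"
    proof
      assume "Suc i < j"
      then have "p (Suc i) \<in> p ` {0..m} \<inter> {a<..<b}" using ij less[of i "Suc i"] less[of "Suc i" j] by auto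
      then show False using B(5) by blast
    qed
    then have "j = Suc i" using \<open>i < j\<close> by simp
    then show "B \<in> (\<lambda>j. {p (j - 1)<..<p j}) ` {1..m}"
      using ij B by (intro image_eqI[of _ _ j]) auto
  next
    fix B assume "B \<in> (\<lambda>j. {p (j - 1)<..<p j}) ` {1..m}"
    then obtain j where j: "1 \<le> j" "j \<le> m" "B = {p (j - 1)<..<p j}" by auto
    then have "p (j - 1) \<in> p ` {0..m}" "p j \<in> p ` {0..m}" "p (j - 1) < p j"
      "p ` {0..m} \<inter> {p (j - 1)<..<p j} = {}"
      using less by auto
    then show "B \<in> gaps (p ` {0..m})" unfolding gaps_def j(3) by blast
  qed
qed

text \<open>Let y be the least moved point. If \<open>g y < y\<close>, then \<open>g y\<close> is
  fixed, against injectivity. If \<open>g y > y\<close>, then the preimage of y lies below y, so it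
  is fixed and equals y.\<close>

lemma strict_mono_finite_fixes:
  fixes g :: "real \<Rightarrow> real"
  assumes "finite A" "g ` A \<subseteq> A" "strict_mono_on A g" "x \<in> A"
  shows "g x = x"
proof (rule ccontr)
  have inj: "inj_on g A" by (rule strict_mono_on_imp_inj_on[OF assms(3)])
  have surj: "g ` A = A" by (rule endo_inj_surj[OF assms(1,2) inj])
  define y where "y = Min {x \<in> A. g x \<noteq> x}"
  assume "g x \<noteq> x"
  then have "y \<in> {x \<in> A. g x \<noteq> x}" unfolding y_def using assms by (intro Min_in) auto
  then have y: "y \<in> A" "g y \<noteq> y" by auto
  have fixed: "g z = z" if "z \<in> A" "z < y" for z
  proof (rule ccontr)
    assume "g z \<noteq> z"
    then have "y \<le> z" unfolding y_def using that assms(1) by (intro Min_le) auto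
    then show False using that by simp
  qed
  consider "g y < y" | "g y > y" using y(2) by linarith
  then show False
  proof cases
    case 1
    then have "g (g y) = g y" using fixed y assms(2) by blast
    then show False using inj_onD[OF inj] y assms(2) by blast
  next
    case 2
    obtain z where z: "z \<in> A" "g z = y" using surj y by (metis imageE)
    have "z < y" using strict_mono_on_leD[OF assms(3), of y z] z y 2 by force
    then show False using fixed z by force
  qed
qed

section \<open>The division of the unit interval\<close>

lemma pl2_bij_isCont:
  assumes "pl2_bij A B f" "open A" "open B" "x \<in> A"
  shows "isCont f x"
  using strict_mono_bij_continuous_on[OF pl2_bij_betw pl2_bij_mono] assms continuous_on_eq_continuous_at
  by blast

text \<open>An end-point inside (0,1) is fixed, so by monotonicity no point crosses it. An end-point
  0 or 1 bounds all values anyway, and g is never evaluated there.\<close>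

lemma pl2_bij_gap_image:
  assumes g: "pl2_bij {0<..<1} {0<..<1} g" and Q: "Q \<subseteq> {0..1}" "\<And>x. x \<in> Q \<Longrightarrow> x \<in> {0<..<1} \<Longrightarrow> g x = x"
    and B: "B \<in> gaps Q"
  shows "g ` B = B"
proof -
  obtain a b where ab: "B = {a<..<b}" "a \<in> Q" "b \<in> Q" "a < b" using B by (rule gapsE)
  have sub: "B \<subseteq> {0<..<1}" using ab Q(1) by fastforce
  have iff: "g x \<in> B \<longleftrightarrow> x \<in> B" if x: "x \<in> {0<..<1}" for x
  proof -
    have less: "g y < g z \<longleftrightarrow> y < z" if "y \<in> {0<..<1}" "z \<in> {0<..<1}" for y z
      using strict_mono_on_less[OF pl2_bij_mono[OF g]] that by blast
    have gx: "g x \<in> {0<..<1}" using pl2_bij_in[OF g x] .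
    have "a < g x \<longleftrightarrow> a < x"
      using less[OF _ x, of a] Q ab x gx by (cases "a \<in> {0<..<1}") force+
    moreover have "g x < b \<longleftrightarrow> x < b"
      using less[OF x, of b] Q ab x gx by (cases "b \<in> {0<..<1}") force+
    ultimately show ?thesis using ab by simp
  qed
  have "y \<in> g ` B" if "y \<in> B" for y
  proof -
    have "y \<in> g ` {0<..<1}" using sub that pl2_bij_image[OF g] by blast
    then show ?thesis using iff that by blast
  qed
  then show ?thesis using iff sub by blast
qed

text \<open>The exponent k is the binary logarithm of the right-hand slope at c. A germ with limit c
  is used instead of a derivative, since c may be 0, where elements of F carry no meaningful
  value.\<close>

definition right_slope :: "real \<Rightarrow> (real \<Rightarrow> real) \<Rightarrow> int \<Rightarrow> bool" where
  "right_slope c g k \<longleftrightarrow> (\<forall>\<^sub>F y in at_right c. g y = c + 2 powi k * (y - c))"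

lemma right_slope_exists:
  assumes g: "pl2_bij {c<..<d} {c<..<d} g" and "c < d"
  shows "\<exists>k. right_slope c g k"
proof -
  obtain S where S: "finite S" "S \<subseteq> dyadic" "\<And>x. x \<in> {c<..<d} - S \<Longrightarrow> locally_affine2 g x"
    using g by (auto simp: pl2_bij_def)
  obtain k b where kb: "\<forall>\<^sub>F y in at_right c. g y = 2 powi (k::int) * y + b"
    using right_germ_affine[OF S(1) \<open>c < d\<close> S(3)] by blast
  have "2 powi k * c + b = c"
    using strict_mono_bij_right_germ[OF pl2_bij_betw[OF g] pl2_bij_mono[OF g] \<open>c < d\<close> kb] .
  then have "2 powi k * y + b = c + 2 powi k * (y - c)" for y by (simp add: algebra_simps)
  then show ?thesis using kb unfolding right_slope_def by auto
qed

lemma right_slope_unique: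
  assumes "right_slope c g k" "right_slope c g l"
  shows "k = l"
proof -
  have "\<forall>\<^sub>F y in at_right c. 2 powi k * y + (c - 2 powi k * c) = 2 powi l * y + (c - 2 powi l * c)"
    using assms unfolding right_slope_def by eventually_elim (simp add: algebra_simps)
  then show ?thesis using affine_unique_at_right(1) by fastforce
qed

text \<open>This is the chain rule at c: h tends to c and stays to the right of it, so the germ of g
  can be evaluated at \<open>h y\<close>.\<close>

lemma right_slope_comp:
  assumes g: "right_slope c g k" and h: "right_slope c h l"
  shows "right_slope c (g \<circ> h) (k + l)"
proof -
  have "((\<lambda>y. c + 2 powi l * (y - c)) \<longlongrightarrow> c + 2 powi l * (c - c)) (at_right c)"
    by (intro tendsto_intros)
  moreover have "\<forall>\<^sub>F y in at_right c. c + 2 powi l * (y - c) = h y"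
    using h unfolding right_slope_def by eventually_elim simp
  ultimately have "(h \<longlongrightarrow> c + 2 powi l * (c - c)) (at_right c)"
    by (rule Lim_transform_eventually)
  then have "(h \<longlongrightarrow> c) (at_right c)" by simp
  moreover have "\<forall>\<^sub>F y in at_right c. h y > c"
    using h eventually_at_right_less[of c] unfolding right_slope_def
    by eventually_elim simp
  ultimately have "filterlim h (at_right c) (at_right c)"
    by (auto simp: filterlim_at elim: eventually_mono)
  then have "\<forall>\<^sub>F y in at_right c. g (h y) = c + 2 powi k * (h y - c)"
    using g unfolding right_slope_def by (rule eventually_compose_filterlim[rotated])
  then show ?thesis
    using h unfolding right_slope_def
  proof eventually_elim
    case (elim y)
    then have "g (h y) = c + 2 powi k * (2 powi l * (y - c))" by simp
    then show ?case by (simp add: power_int_add mult.assoc)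
  qed
qed

lemma right_slope_cong:
  assumes "right_slope c g k" "c < d" "\<And>y. y \<in> {c<..<d} \<Longrightarrow> g y = h y"
  shows "right_slope c h k"
proof -
  have "\<forall>\<^sub>F y in at_right c. y \<in> {c<..<d}"
    using assms(2) by (auto simp: eventually_at_right_field)
  then show ?thesis
    using assms(1) unfolding right_slope_def by eventually_elim (simp add: assms(3))
qed

section \<open>Boundary points of the fixed-point set and the gaps between them\<close>

locale Thompson_element =
  fixes f :: "real \<Rightarrow> real"
  assumes f: "f \<in> carrier Thompson_F"
begin

lemma pl2_f: "pl2_bij {0<..<1} {0<..<1} f"
  using f by (rule Thompson_F_pl2_bij)

text \<open>These are the values of a division. Being on the boundary is phrased through
  neighbourhoods because that form is easily transported along a map commuting with f.\<close>

definition division_points :: "real set" where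
  "division_points = {x \<in> {0<..<1}. f x = x \<and> \<not> (\<forall>\<^sub>F y in nhds x. f y = y)} \<union> {0, 1}"

abbreviation dyadic_division_points :: "real set" where
  "dyadic_division_points \<equiv> division_points \<inter> dyadic"

lemma division_points_subset: "division_points \<subseteq> {0..1}"
  by (auto simp: division_points_def)

lemma f_division_point: "x \<in> division_points \<Longrightarrow> x \<in> {0<..<1} \<Longrightarrow> f x = x"
  by (auto simp: division_points_def)

text \<open>By continuity the fixed-point set is closed in (0,1), so its relative frontier is what
  remains after removing its interior.\<close>

lemma frontier_fixpts: "top_of_set {0<..<1} frontier_of fixpts f = division_points - {0, 1}"
proof -
  have "closedin (top_of_set {0<..<1}) {x \<in> {0<..<1}. f x - x = 0}"
    by (intro continuous_closedin_preimage_constant continuous_intros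
        strict_mono_bij_continuous_on[OF pl2_bij_betw[OF pl2_f] pl2_bij_mono[OF pl2_f]]
        open_greaterThanLessThan)
  then have closed: "closedin (top_of_set {0<..<1}) (fixpts f)"
    by (simp add: fixpts_def)
  have "top_of_set {0<..<1} interior_of fixpts f = {0<..<1} \<inter> interior (fixpts f)"
    by (subst interior_of_subtopology_open) auto
  then have "top_of_set {0<..<1} frontier_of fixpts f = fixpts f - interior (fixpts f)"
    using closed by (auto simp: frontier_of_def closure_of_closedin fixpts_def)
  moreover have "x \<in> interior (fixpts f) \<longleftrightarrow> (\<forall>\<^sub>F y in nhds x. f y = y)" if "x \<in> {0<..<1}" for x
  proof -
    have "x \<in> interior (fixpts f) \<longleftrightarrow> (\<forall>\<^sub>F y in nhds x. y \<in> fixpts f)"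
      by (simp add: interior_def eventually_nhds subset_iff) blast
    also have "\<dots> \<longleftrightarrow> (\<forall>\<^sub>F y in nhds x. f y = y)"
      by (rule eventually_cong[OF eventually_nhds_in_open[of "{0<..<1}" x]])
        (use that in \<open>auto simp: fixpts_def\<close>)
    finally show ?thesis .
  qed
  ultimately show ?thesis by (auto simp: division_points_def fixpts_def)
qed

text \<open>Between consecutive breaks f is affine, and an affine map with two fixed points is the
  identity. Such a piece thus contains at most one division point: two would make f the identity
  around both.\<close>

lemma finite_division_points: "finite division_points"
proof -
  obtain S where S: "finite S" "S \<subseteq> dyadic" "\<And>x. x \<in> {0<..<1} - S \<Longrightarrow> locally_affine2 f x"
    using pl2_f by (auto simp: pl2_bij_def)
  define Q where "Q = (S \<inter> {0<..<1}) \<union> {0, 1}"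
  have Q: "finite Q" "{0, 1} \<subseteq> Q" "Q \<subseteq> {0..1}" using S(1) by (auto simp: Q_def)
  have "finite (division_points \<inter> G)" if G: "G \<in> gaps Q" for G
  proof -
    obtain a b where ab: "G = {a<..<b}" using G by (rule gapsE)
    have sub: "G \<subseteq> {0<..<1} - Q" using Union_gaps[OF Q] G by blast
    then have "locally_affine2 f x" if "x \<in> {a<..<b}" for x
      using S(3) that unfolding ab Q_def by blast
    then obtain k e where ke: "\<forall>x\<in>G. f x = 2 powi (k::int) * x + e"
      using affine_on_interval ab by blast
    have "x = y" if xy: "x \<in> division_points \<inter> G" "y \<in> division_points \<inter> G" for x y
    proof (rule ccontr)
      assume "x \<noteq> y"
      have "2 powi k * x + e = x" "2 powi k * y + e = y"
        using ke xy f_division_point sub by (metis Diff_iff Int_iff subsetD)+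
      then have "(2 powi k - 1) * (x - y) = 0" by (simp add: algebra_simps)
      then have "2 powi k = (1::real)" using \<open>x \<noteq> y\<close> by simp
      then have "f z = z" if "z \<in> G" for z
        using ke that \<open>2 powi k * x + e = x\<close> by simp
      then have "\<forall>\<^sub>F z in nhds x. f z = z"
        using eventually_nhds_in_open[OF gaps_open[OF G], of x] xy by (auto elim: eventually_mono)
      then show False using xy sub Q(2) by (auto simp: division_points_def)
    qed
    then have "division_points \<inter> G \<subseteq> {SOME x. x \<in> division_points \<inter> G}"
      by (metis someI singletonI subsetI)
    then show ?thesis by (rule finite_subset) simp
  qed
  then have "finite (Q \<union> (\<Union>G\<in>gaps Q. division_points \<inter> G))"
    using Q finite_gaps by blast
  moreover have "division_points \<subseteq> Q \<union> (\<Union>G\<in>gaps Q. division_points \<inter> G)"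
  proof
    fix x assume x: "x \<in> division_points"
    show "x \<in> Q \<union> (\<Union>G\<in>gaps Q. division_points \<inter> G)"
    proof (cases "x \<in> Q")
      case False
      then have "x \<in> \<Union>(gaps Q)" using Union_gaps[OF Q] x Q(2) by (auto simp: division_points_def)
      then show ?thesis using x by blast
    qed simp
  qed
  ultimately show ?thesis by (rule finite_subset[rotated])
qed

lemma dyadic_division_points_properties:
  "finite dyadic_division_points" "{0, 1} \<subseteq> dyadic_division_points" "dyadic_division_points \<subseteq> {0..1}"
  using finite_division_points division_points_subset by (auto simp: division_points_def)

lemma division_points_properties:
  "finite division_points" "{0, 1} \<subseteq> division_points" "division_points \<subseteq> {0..1}"
  using finite_division_points division_points_subset by (auto simp: division_points_def)

lemma gap_subset_unit: "B \<in> gaps dyadic_division_points \<Longrightarrow> B \<subseteq> {0<..<1}"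
  using Union_gaps[OF dyadic_division_points_properties] by blast

text \<open>The only points where a gap could start to differ from the fixed-point set are division points
  that are not dyadic; there \<open>f\<close> is affine, hence not the identity on any nearby interval.\<close>

lemma gap_subset_fixpts:
  assumes B: "B \<in> gaps dyadic_division_points" and x: "x \<in> B" "f x = x" "x \<notin> division_points"
  shows "B \<subseteq> fixpts f"
proof
  \<comment> \<open>\<open>W y\<close> says that f is the identity around y. It is locally constant
    on B, and it holds at x, a fixed point that is not a division point; hence it holds on the whole
    connected gap.\<close>
  define W where "W y \<longleftrightarrow> (\<forall>\<^sub>F z in nhds y. f z = z)" for y
  have B01: "B \<subseteq> {0<..<1}" using gap_subset_unit[OF B] .
  have local: "\<forall>\<^sub>F z in nhds y. W y = W z" if y: "y \<in> B" for y
  proof (cases "W y")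
    case True
    then have "\<forall>\<^sub>F z in nhds y. W z" by (simp add: W_def eventually_eventually)
    then show ?thesis using True by simp
  next
    case nW: False
    show ?thesis
    proof (cases "f y = y")
      case True
      then have "y \<in> division_points" using nW y B01 by (auto simp: division_points_def W_def)
      then have "y \<notin> dyadic" using y gaps_disjoint_points[OF B] by blast
      then obtain k b where "\<forall>\<^sub>F z in nhds y. f z = 2 powi (k::int) * z + b"
        using pl2_bij_locally_affine2[OF pl2_f] y B01 unfolding locally_affine2_def by blast
      then have "\<forall>\<^sub>F z in nhds y. \<forall>\<^sub>F w in nhds z. f w = 2 powi k * w + b"
        and affine: "\<forall>\<^sub>F z in nhds y. f z = 2 powi k * z + b"
        by (simp_all add: eventually_eventually)
      \<comment> \<open>The affine germ at y is valid around every z close to y. If f were the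
        identity around such a z, this germ would be the identity, giving
        \<open>W y\<close>.\<close>
      then have "\<forall>\<^sub>F z in nhds y. \<not> W z"
      proof eventually_elim
        case (elim z)
        show ?case
        proof
          assume "W z"
          with elim(1) have "\<forall>\<^sub>F w in nhds z. 2 powi k * w + b = 1 * w + 0"
            unfolding W_def by eventually_elim simp
          then have "\<forall>\<^sub>F w in at_right z. 2 powi k * w + b = 1 * w + 0"
            by (auto simp: eventually_at_filter elim: eventually_mono)
          then have "2 powi k = (1::real)" "b = 0" using affine_unique_at_right by blast+
          then have "W y" using affine by (simp add: W_def)
          then show False using nW by simp
        qed
      qed
      then show ?thesis using nW by simp
    next
      case False
      have "isCont f y" using pl2_bij_isCont[OF pl2_f] y B01 by auto
      then have "(f \<longlongrightarrow> f y) (nhds y)" by (simp add: continuous_within tendsto_at_iff_tendsto_nhds)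
      then have "((\<lambda>z. f z - z) \<longlongrightarrow> f y - y) (nhds y)" by (intro tendsto_intros filterlim_ident)
      then have "\<forall>\<^sub>F z in nhds y. f z - z \<noteq> 0"
        by (rule tendsto_imp_eventually_ne) (use False in simp)
      then have "\<forall>\<^sub>F z in nhds y. \<not> W z"
        by eventually_elim (auto simp: W_def dest: eventually_nhds_x_imp_x)
      then show ?thesis using nW by simp
    qed
  qed
  have "W x" using x B01 by (auto simp: division_points_def W_def)
  fix y assume y: "y \<in> B"
  have "W x = W y"
  proof (rule connected_local_const[OF gaps_connected[OF B] x(1) y])
    show "\<forall>x\<in>B. \<forall>\<^sub>F y in at x within B. W x = W y"
    proof
      fix x assume "x \<in> B"
      show "\<forall>\<^sub>F y in at x within B. W x = W y"
        unfolding eventually_at_filter by (rule eventually_mono[OF local[OF \<open>x \<in> B\<close>]]) simp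
    qed
  qed
  then have "f y = y" using \<open>W x\<close> by (auto simp: W_def dest: eventually_nhds_x_imp_x)
  then show "y \<in> fixpts f" using y B01 by (auto simp: fixpts_def)
qed

text \<open>A fixed gap is maximal because its end-points are division points or 0 or 1. Conversely,
  a point of a fix domain lies in a gap that is then fixed entirely, and two components sharing a
  point coincide. In particular fix domains have dyadic end-points, a fact that their definition
  does not state.\<close>

lemma fix_domains_eq: "fix_domains f = {B \<in> gaps dyadic_division_points. B \<subseteq> fixpts f}"
proof -
  have not_division: "x \<notin> division_points" if "open C" "C \<subseteq> fixpts f" "x \<in> C" for x C
  proof -
    have "\<forall>\<^sub>F y in nhds x. f y = y"
      using eventually_nhds_in_open[OF that(1,3)] that(2)
      by (auto simp: fixpts_def elim!: eventually_mono)
    then show ?thesis using that by (auto simp: division_points_def fixpts_def)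
  qed
  have sub: "{B \<in> gaps dyadic_division_points. B \<subseteq> fixpts f} \<subseteq> fix_domains f"
  proof
    fix B assume "B \<in> {B \<in> gaps dyadic_division_points. B \<subseteq> fixpts f}"
    then have B: "B \<in> gaps dyadic_division_points" "B \<subseteq> fixpts f" by auto
    then obtain a b where ab: "B = {a<..<b}" "a \<in> dyadic_division_points" "b \<in> dyadic_division_points" "a < b"
      by (metis gapsE)
    have "C' = B" if C': "open C'" "connected C'" "B \<subseteq> C'" "C' \<subseteq> fixpts f" for C'
    proof -
      have "a \<notin> C'" "b \<notin> C'" using not_division[OF C'(1,4)] ab by auto
      then have "{a<..<b} \<in> components C'"
        using C' ab by (intro Ioo_in_components) auto
      then show ?thesis using C' ab(1) by (auto simp: in_components_maximal)
    qed
    then show "B \<in> fix_domains f"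
      using B gaps_open gaps_connected gaps_nonempty by (auto simp: fix_domains_def)
  qed
  moreover have "C \<in> gaps dyadic_division_points \<and> C \<subseteq> fixpts f" if C: "C \<in> fix_domains f" for C
  proof -
    have C': "open C" "C \<noteq> {}" "C \<subseteq> fixpts f" using C by (auto simp: fix_domains_def)
    then obtain x where x: "x \<in> C" by blast
    then have fx: "x \<in> {0<..<1}" "f x = x" using C' by (auto simp: fixpts_def)
    have nd: "x \<notin> division_points" using not_division C' x by blast
    then obtain B where B: "B \<in> gaps dyadic_division_points" "x \<in> B"
      using Union_gaps[OF dyadic_division_points_properties] fx by blast
    then have "B \<subseteq> fixpts f" using gap_subset_fixpts fx nd by blast
    then have "B \<in> fix_domains f" using B(1) sub by blast
    then have "C = B"
      using C B x components_eq[of C "interior (fixpts f)" B] by (auto simp: fix_domains_eq_components)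
    then show ?thesis using B C' by simp
  qed
  ultimately show ?thesis by blast
qed

text \<open>This is \<open>gap_subset_fixpts\<close> read backwards. It supplies the non-dyadic
  points at which commuting elements must be affine.\<close>

lemma fixed_in_bump_gap:
  assumes "B \<in> gaps dyadic_division_points" "\<not> B \<subseteq> fixpts f" "x \<in> B" "f x = x"
  shows "x \<in> division_points" "x \<notin> dyadic"
proof -
  show "x \<in> division_points" using gap_subset_fixpts[OF assms(1,3,4)] assms(2) by blast
  then show "x \<notin> dyadic" using gaps_disjoint_points[OF assms(1)] assms(3) by blast
qed

text \<open>The complement of the frontier has the gaps of \<open>division_points\<close> as
  components, and the gaps determine the points.\<close>

lemma division_iff:
  "division f m p \<longleftrightarrow> p 0 = 0 \<and> p m = 1 \<and> strict_mono_on {0..m} p \<and> p ` {0..m} = division_points"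
proof -
  have comp: "components ({0<..<1} - (top_of_set {0<..<1} frontier_of fixpts f)) = gaps division_points"
  proof -
    have "{0<..<1} - (division_points - {0, 1}) = {0<..<1} - division_points" by auto
    then show ?thesis
      using components_diff_finite[OF division_points_properties] by (simp add: frontier_fixpts)
  qed
  have "(\<lambda>j. {p (j - 1)<..<p j}) ` {1..m} = gaps division_points \<longleftrightarrow> p ` {0..m} = division_points"
    if p: "p 0 = 0" "p m = 1" "strict_mono_on {0..m} p"
  proof -
    have "{0, 1} \<subseteq> p ` {0..m}" using p by force
    moreover have "p ` {0..m} \<subseteq> {0..1}"
      using strict_mono_on_leD[OF p(3), of 0] strict_mono_on_leD[OF p(3), of _ m] p(1,2) by auto
    ultimately show ?thesis
      using gaps_enumeration[OF p(3)] gaps_inject[OF _ _ _ division_points_properties, of "p ` {0..m}"]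
      by auto
  qed
  then show ?thesis unfolding division_def comp by blast
qed

text \<open>The map \<open>\<beta>\<close> sends a chain to its span. The second clause keeps track
  of the members: they are gaps of the finer set of all division points, so commuting elements
  preserve each of them.\<close>

lemma bump_chains_bij:
  "\<exists>\<beta>. bij_betw \<beta> (bump_chains f) {B \<in> gaps dyadic_division_points. \<not> B \<subseteq> fixpts f} \<and>
     (\<forall>Ds\<in>bump_chains f. \<forall>D\<in>set Ds. D \<in> gaps division_points \<and> D \<subseteq> \<beta> Ds)"
proof -
  have "division_points \<noteq> {}" by (auto simp: division_points_def)
  from strict_mono_on_enumeration[OF finite_division_points this]
  obtain m :: nat and p where p: "strict_mono_on {0..m} p" "p ` {0..m} = division_points" by blast
  have less: "p i < p j \<longleftrightarrow> i < j" and le: "p i \<le> p j \<longleftrightarrow> i \<le> j" if "i \<le> m" "j \<le> m" for i j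
    using strict_mono_on_less[OF p(1), of i j] strict_mono_on_less_eq[OF p(1), of i j] that by auto
  have in_points: "p j \<in> division_points" if "j \<le> m" for j using p(2) that by auto
  have index: "\<exists>j\<le>m. y = p j" if "y \<in> division_points" for y
    using that unfolding p(2)[symmetric] by auto
  have "p 0 = 0" "p m = 1"
  proof -
    obtain i j where "p i = 0" "i \<le> m" "p j = 1" "j \<le> m"
      using p(2) division_points_properties(2) by (metis (no_types, lifting) atLeastAtMost_iff imageE insert_subset)
    then show "p 0 = 0" "p m = 1"
      using le[of 0 i] le[of j m] in_points[of 0] in_points[of m] division_points_subset by force+
  qed
  then have div: "division f m p" using p by (simp add: division_iff)
  \<comment> \<open>Chains are defined by quantifying over divisions; uniqueness lets the single
    enumeration p describe all of them.\<close>
  have div_unique: "m' = m" "\<And>j. j \<le> m \<Longrightarrow> p' j = p j" if "division f m' p'" for m' p'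
  proof -
    have p': "strict_mono_on {0..m'} p'" "p' ` {0..m'} = p ` {0..m}"
      using that p(2) by (simp_all add: division_iff)
    show m': "m' = m" using strict_mono_on_enumeration_unique(1)[OF p'(1) p(1) p'(2)] .
    show "p' j = p j" if "j \<le> m" for j
      using strict_mono_on_enumeration_unique(2)[OF p'(1) p(1) p'(2)] that m' by simp
  qed
  define T where "T = {(t, u). 1 \<le> t \<and> t \<le> u \<and> u \<le> m \<and>
     (\<forall>j \<in> {t..u}. {p (j - 1)<..<p j} \<in> bump_domains f) \<and>
     (\<forall>j \<in> {t - 1..u}. p j \<in> dyadic \<longleftrightarrow> j = t - 1 \<or> j = u)}"
  define chain where "chain t u = map (\<lambda>j. {p (j - 1)<..<p j}) [t..<Suc u]" for t u
  have chains: "bump_chains f = (\<lambda>(t, u). chain t u) ` T"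
  proof
    show "(\<lambda>(t, u). chain t u) ` T \<subseteq> bump_chains f"
      using div unfolding bump_chains_def T_def chain_def by fast
    show "bump_chains f \<subseteq> (\<lambda>(t, u). chain t u) ` T"
    proof
      fix Ds assume "Ds \<in> bump_chains f"
      then obtain m' p' t u where 1: "division f m' p'" "1 \<le> t" "t \<le> u" "u \<le> m'"
        "\<And>j. j \<in> {t..u} \<Longrightarrow> {p' (j - 1)<..<p' j} \<in> bump_domains f"
        "\<And>j. j \<in> {t - 1..u} \<Longrightarrow> p' j \<in> dyadic \<longleftrightarrow> j = t - 1 \<or> j = u"
        "Ds = map (\<lambda>j. {p' (j - 1)<..<p' j}) [t..<Suc u]"
        unfolding bump_chains_def by blast
      have eq: "p' j = p j" if "j \<le> u" for j using div_unique[OF 1(1)] 1(4) that by simp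
      have eq': "p' (j - 1) = p (j - 1)" if "j \<le> u" for j using eq[of "j - 1"] that by linarith
      have "{p (j - 1)<..<p j} \<in> bump_domains f" if "j \<in> {t..u}" for j
        using 1(5)[OF that] eq[of j] eq'[of j] that by simp
      moreover have "p j \<in> dyadic \<longleftrightarrow> j = t - 1 \<or> j = u" if "j \<in> {t - 1..u}" for j
        using 1(6)[OF that] eq[of j] that by simp
      ultimately have "(t, u) \<in> T"
        unfolding T_def using 1(2-4) div_unique(1)[OF 1(1)] by simp
      moreover have "Ds = chain t u"
        unfolding 1(7) chain_def using eq eq' by (intro map_cong) (auto simp del: upt_Suc)
      ultimately show "Ds \<in> (\<lambda>(t, u). chain t u) ` T" by blast
    qed
  qed
  \<comment> \<open>A chain is stored only as a list of intervals, so the ends of its span are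
    recovered by \<open>Inf\<close> and \<open>Sup\<close>.\<close>
  define \<beta> where "\<beta> Ds = {Inf (hd Ds)<..<Sup (last Ds)}" for Ds :: "real set list"
  have \<beta>: "\<beta> (chain t u) = {p (t - 1)<..<p u}" if "(t, u) \<in> T" for t u
  proof -
    have tu: "1 \<le> t" "t \<le> u" "u \<le> m" using that by (auto simp: T_def)
    then have "hd (chain t u) = {p (t - 1)<..<p t}" "last (chain t u) = {p (u - 1)<..<p u}"
      by (simp_all add: chain_def hd_map last_map del: upt_Suc)
    moreover have "p (t - 1) < p t" "p (u - 1) < p u"
      using less[of "t - 1" t] less[of "u - 1" u] tu by auto
    ultimately show ?thesis by (simp add: \<beta>_def)
  qed
  have block: "{p (t - 1)<..<p u} \<in> gaps dyadic_division_points" "\<not> {p (t - 1)<..<p u} \<subseteq> fixpts f"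
    if T: "(t, u) \<in> T" for t u
  proof -
    have tu: "1 \<le> t" "t \<le> u" "u \<le> m" and bump: "{p (t - 1)<..<p t} \<in> bump_domains f"
      and dy: "\<And>j. j \<in> {t - 1..u} \<Longrightarrow> p j \<in> dyadic \<longleftrightarrow> j = t - 1 \<or> j = u"
      using T by (auto simp: T_def)
    have "p (t - 1) \<in> dyadic_division_points" "p u \<in> dyadic_division_points" "p (t - 1) < p u"
      using tu dy[of "t - 1"] dy[of u] in_points less[of "t - 1" u] by auto
    moreover have "dyadic_division_points \<inter> {p (t - 1)<..<p u} = {}"
    proof -
      have False if y: "y \<in> dyadic_division_points" "y \<in> {p (t - 1)<..<p u}" for y
      proof -
        obtain j where j: "y = p j" "j \<le> m" using y(1) index[of y] by blast
        then have "t - 1 < j" "j < u" using y(2) less[of "t - 1" j] less[of j u] tu by auto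
        then show False using dy[of j] y(1) j(1) by auto
      qed
      then show ?thesis by blast
    qed
    ultimately show "{p (t - 1)<..<p u} \<in> gaps dyadic_division_points"
      unfolding gaps_def by blast
    \<comment> \<open>The first member of the chain is a non-empty bump domain, so it supplies a
      moved point of the span.\<close>
    have "{p (t - 1)<..<p t} \<subseteq> {p (t - 1)<..<p u}" using le[of t u] tu by auto
    then show "\<not> {p (t - 1)<..<p u} \<subseteq> fixpts f"
      using in_components_nonempty[OF bump[unfolded bump_domains_def]]
        in_components_subset[OF bump[unfolded bump_domains_def]] by blast
  qed
  have surj: "\<exists>(t, u) \<in> T. B = {p (t - 1)<..<p u}"
    if B: "B \<in> gaps dyadic_division_points" "\<not> B \<subseteq> fixpts f" for B
  proof -
    obtain c d where cd: "B = {c<..<d}" "c \<in> dyadic_division_points" "d \<in> dyadic_division_points" "c < d"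
      "dyadic_division_points \<inter> {c<..<d} = {}" using B(1) by (rule gapsE)
    obtain i u where iu: "c = p i" "d = p u" "i \<le> m" "u \<le> m"
      using cd(2,3) index[of c] index[of d] by blast
    have "i < u" using cd(4) iu less by blast
    have dy: "p j \<in> dyadic \<longleftrightarrow> j = i \<or> j = u" if "j \<in> {i..u}" for j
    proof
      assume "p j \<in> dyadic"
      then have "p j \<notin> {c<..<d}" using cd(5) in_points[of j] that iu by auto
      then show "j = i \<or> j = u" using iu less[of i j] less[of j u] that by auto
    qed (use cd iu in auto)
    have bump: "{p (j - 1)<..<p j} \<in> bump_domains f" if j: "j \<in> {Suc i..u}" for j
      unfolding bump_domains_def
    proof (rule Ioo_in_components)
      show "p (j - 1) < p j" using less[of "j - 1" j] j iu by auto
      have gap: "{p (j - 1)<..<p j} \<in> gaps division_points"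
        using gaps_enumeration[OF p(1)] p(2) j iu by auto
      have "{p (j - 1)<..<p j} \<subseteq> B"
      proof -
        have "p i \<le> p (j - 1)" "p j \<le> p u"
          using le[of i "j - 1"] le[of j u] j iu by simp_all linarith+
        then show ?thesis using iu cd(1) by auto
      qed
      then show "{p (j - 1)<..<p j} \<subseteq> {0<..<1} - fixpts f"
        using fixed_in_bump_gap(1)[OF B] gaps_disjoint_points[OF gap] gap_subset_unit[OF B(1)]
        unfolding fixpts_def by blast
      show "p (j - 1) \<notin> {0<..<1} - fixpts f" "p j \<notin> {0<..<1} - fixpts f"
        using f_division_point[OF in_points[of "j - 1"]] f_division_point[OF in_points[of j]] j iu
        by (simp_all add: fixpts_def) linarith+
    qed
    \<comment> \<open>A chain whose first index is t begins at \<open>p (t - 1)\<close>, and the gap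
      begins at \<open>p i\<close>; hence t is \<open>Suc i\<close>.\<close>
    have "(Suc i, u) \<in> T" unfolding T_def using \<open>i < u\<close> iu dy bump by auto
    then show ?thesis using cd iu by force
  qed
  have inj: "t = t' \<and> u = u'" if "(t, u) \<in> T" "(t', u') \<in> T"
    "{p (t - 1)<..<p u} = {p (t' - 1)<..<p u'}" for t u t' u'
  proof -
    have tu: "1 \<le> t" "t \<le> u" "u \<le> m" "1 \<le> t'" "t' \<le> u'" "u' \<le> m" using that by (auto simp: T_def)
    have "p (t - 1) < p u" using less[of "t - 1" u] tu by auto
    from Ioo_eq_iff[OF this that(3)] have "p (t - 1) = p (t' - 1)" "p u = p u'" by auto
    moreover have "t - 1 \<le> m" "t' - 1 \<le> m" using tu by linarith+
    ultimately have "t - 1 = t' - 1" "u = u'"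
      using le[of "t - 1" "t' - 1"] le[of "t' - 1" "t - 1"] le[of u u'] le[of u' u] tu by auto
    then show ?thesis using tu by auto
  qed
  have "bij_betw \<beta> (bump_chains f) {B \<in> gaps dyadic_division_points. \<not> B \<subseteq> fixpts f}"
    unfolding bij_betw_def
  proof
    show "inj_on \<beta> (bump_chains f)"
    proof (rule inj_onI)
      fix Ds Ds' assume "Ds \<in> bump_chains f" "Ds' \<in> bump_chains f" and eq: "\<beta> Ds = \<beta> Ds'"
      then obtain t u t' u' where T: "(t, u) \<in> T" "(t', u') \<in> T" "Ds = chain t u" "Ds' = chain t' u'"
        unfolding chains by auto
      then show "Ds = Ds'" using inj[OF T(1,2)] eq \<beta> by auto
    qed
    show "\<beta> ` bump_chains f = {B \<in> gaps dyadic_division_points. \<not> B \<subseteq> fixpts f}"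
    proof
      show "\<beta> ` bump_chains f \<subseteq> {B \<in> gaps dyadic_division_points. \<not> B \<subseteq> fixpts f}"
        unfolding chains using block \<beta> by auto
      show "{B \<in> gaps dyadic_division_points. \<not> B \<subseteq> fixpts f} \<subseteq> \<beta> ` bump_chains f"
      proof
        fix B assume "B \<in> {B \<in> gaps dyadic_division_points. \<not> B \<subseteq> fixpts f}"
        then obtain t u where "(t, u) \<in> T" "B = {p (t - 1)<..<p u}" using surj by blast
        then have "B = \<beta> (chain t u)" "chain t u \<in> bump_chains f" using \<beta> unfolding chains by auto
        then show "B \<in> \<beta> ` bump_chains f" by blast
      qed
    qed
  qed
  moreover have "D \<in> gaps division_points \<and> D \<subseteq> \<beta> Ds" if Ds: "Ds \<in> bump_chains f" "D \<in> set Ds" for Ds D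
  proof -
    obtain t u where T: "(t, u) \<in> T" "Ds = chain t u" using Ds(1) chains by auto
    then have tu: "1 \<le> t" "t \<le> u" "u \<le> m" by (auto simp: T_def)
    have "D \<in> (\<lambda>j. {p (j - 1)<..<p j}) ` {t..u}"
      using Ds(2) T(2) by (simp add: chain_def atLeastLessThanSuc_atLeastAtMost del: upt_Suc)
    then obtain j where j: "j \<in> {t..u}" "D = {p (j - 1)<..<p j}" by blast
    have "D \<in> gaps division_points"
      using gaps_enumeration[OF p(1)] p(2) j tu by auto
    moreover have "D \<subseteq> \<beta> Ds"
    proof -
      have "t - 1 \<le> m" "j - 1 \<le> m" "t - 1 \<le> j - 1" "j \<le> u" using j(1) tu by auto
      then have "p (t - 1) \<le> p (j - 1)" "p j \<le> p u"
        using le[of "t - 1" "j - 1"] le[of j u] tu by auto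
      then show ?thesis unfolding T(2) \<beta>[OF T(1)] j(2) by auto
    qed
    ultimately show ?thesis by blast
  qed
  ultimately show ?thesis by blast
qed

end

section \<open>The centralizer\<close>

text \<open>The map has slope 2 up to x and slope 1 beyond it, so x is its only possible break and
  the unit interval is lengthened by x.\<close>

lemma pl2_bij_stretch:
  fixes x :: real
  assumes x: "x \<in> dyadic" "0 \<le> x" "x < 1"
  shows "pl2_bij {0<..<1} {0<..<1 + x} (\<lambda>t. t + min t x)"
proof -
  have "bij_betw (\<lambda>t. t + min t x) {0<..<1} {0<..<1 + x}"
    by (rule bij_betw_byWitness[where f' = "\<lambda>y. if y \<le> 2 * x then y / 2 else y - x"])
      (use x in \<open>auto simp: min_def field_simps split: if_splits\<close>)
  moreover have "strict_mono_on {0<..<1} (\<lambda>t. t + min t x)"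
    by (rule strict_mono_onI) (auto simp: min_def)
  moreover have "t + min t x \<in> dyadic \<longleftrightarrow> t \<in> dyadic" for t
    using dyadic_powi_mult_iff[of 1 t] dyadic_add_iff[OF x(1), of t] by (auto simp: min_def)
  moreover have "locally_affine2 (\<lambda>t. t + min t x) t" if "t \<noteq> x" for t
  proof (cases "t < x")
    case True
    then have "\<forall>\<^sub>F s in nhds t. s < x" using eventually_nhds_in_open[of "{..<x}" t] by auto
    then have "\<forall>\<^sub>F s in nhds t. s + min s x = 2 powi 1 * s + 0" by eventually_elim (auto simp: min_def)
    then show ?thesis unfolding locally_affine2_def by blast
  next
    case False
    then have "\<forall>\<^sub>F s in nhds t. x < s" using eventually_nhds_in_open[of "{x<..}" t] that by auto
    then have "\<forall>\<^sub>F s in nhds t. s + min s x = 2 powi 0 * s + x" by eventually_elim (auto simp: min_def)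
    then show ?thesis unfolding locally_affine2_def by blast
  qed
  then have "\<exists>S. finite S \<and> S \<subseteq> dyadic \<and> (\<forall>t \<in> {0<..<1} - S. locally_affine2 (\<lambda>t. t + min t x) t)"
    using x(1) by (intro exI[of _ "{x}"]) auto
  ultimately show ?thesis by (simp add: pl2_bij_def)
qed

text \<open>Writing the length of the target as \<open>2\<^sup>k * (1 + x)\<close> with \<open>0 \<le> x < 1\<close>, two pieces of slopes
  \<open>2\<^sup>k\<^sup>+\<^sup>1\<close> and \<open>2\<^sup>k\<close> suffice.\<close>

lemma exists_pl2_bij:
  assumes "c \<in> dyadic" "d \<in> dyadic" "c < d"
  shows "\<exists>\<phi>. pl2_bij {0<..<1} {c<..<d} \<phi>"
proof -
  \<comment> \<open>This is the largest power of two not exceeding the length, which is what puts x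
    into [0,1).\<close>
  define k where "k = \<lfloor>log 2 (d - c)\<rfloor>"
  define x where "x = 2 powi (- k) * (d - c) - 1"
  have k: "2 powi k \<le> d - c" "d - c < 2 powi k * 2"
  proof -
    have "2 powr k \<le> d - c" "d - c < 2 powr (k + 1)"
      using floor_log_eq_powr_iff[of "d - c" 2 k] assms(3) by (simp_all add: k_def)
    then show "2 powi k \<le> d - c" "d - c < 2 powi k * 2"
      using powr_real_of_int'[of 2 k] by (simp_all add: powr_add)
  qed
  have d: "2 powi k * (1 + x) + c = d" by (simp add: x_def power_int_minus field_simps)
  have "0 \<le> x" "x < 1" using k by (simp_all add: x_def power_int_minus field_simps)
  moreover have "x \<in> dyadic"
    unfolding x_def using dyadic_diff[OF _ dyadic_1] dyadic_diff[OF assms(2,1)] by simp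
  ultimately have "pl2_bij {0<..<1} {0<..<1 + x} (\<lambda>t. t + min t x)" by (intro pl2_bij_stretch)
  moreover have "pl2_bij {0<..<1 + x} {2 powi k * 0 + c<..<2 powi k * (1 + x) + c} (\<lambda>y. 2 powi k * y + c)"
    by (rule pl2_bij_affine[OF assms(1) refl])
  ultimately show ?thesis using pl2_bij_comp d by fastforce
qed

text \<open>Take the least positive value m, attained at y. The remainder of \<open>h z\<close>
  modulo m is the value at z times a power of y, so it vanishes by minimality.\<close>

lemma hom_integer_group_generator:
  assumes "group G" and h: "h \<in> hom G integer_group" and "x \<in> carrier G" "h x \<noteq> 0"
  shows "\<exists>n>0. \<exists>y\<in>carrier G. h y = n \<and> (\<forall>z\<in>carrier G. n dvd h z)"
proof -
  interpret group_hom G integer_group h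
    using assms by (simp add: group_hom_def group_hom_axioms_def)
  define Q where "Q m \<longleftrightarrow> m > 0 \<and> (\<exists>y\<in>carrier G. h y = int m)" for m
  \<comment> \<open>Raising x to the sign of its value makes that value positive, so that a least
    positive value exists.\<close>
  have "h (x [^]\<^bsub>G\<^esub> sgn (h x)) = \<bar>h x\<bar>"
    using hom_int_pow[OF assms(3)] by (simp add: abs_sgn)
  then have "Q (nat \<bar>h x\<bar>)"
    using assms(3,4) unfolding Q_def by (auto intro!: bexI[of _ "x [^]\<^bsub>G\<^esub> sgn (h x)"])
  then have "Q (LEAST m. Q m)" by (rule LeastI)
  then obtain m y where m: "m = (LEAST m. Q m)" "m > 0" "y \<in> carrier G" "h y = int m"
    unfolding Q_def by blast
  have "int m dvd h z" if z: "z \<in> carrier G" for z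
  proof -
    let ?r = "h z mod int m"
    have "h (z \<otimes>\<^bsub>G\<^esub> y [^]\<^bsub>G\<^esub> (- (h z div int m))) = ?r"
      using hom_int_pow[OF m(3)] z m(3,4) by (simp add: minus_div_mult_eq_mod mult.commute flip: minus_mult_div_eq_mod)
    moreover have "0 \<le> ?r" "?r < int m" using m(2) by simp_all
    moreover have "z \<otimes>\<^bsub>G\<^esub> y [^]\<^bsub>G\<^esub> (- (h z div int m)) \<in> carrier G" using z m(3) by simp
    ultimately have "?r > 0 \<Longrightarrow> Q (nat ?r)" unfolding Q_def by fastforce
    then have "\<not> ?r > 0"
      using not_less_Least[of "nat ?r" Q] m(1) \<open>?r < int m\<close> \<open>0 \<le> ?r\<close> by (auto simp: nat_less_iff)
    then show ?thesis using \<open>0 \<le> ?r\<close> by (simp add: dvd_eq_mod_eq_0)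
  qed
  then show ?thesis using m by (intro exI[of _ "int m"]) auto
qed

text \<open>The witnesses are q = |s f| and p = s g * sgn (s f). Moving the sign into p keeps q
  positive.\<close>

lemma hom_integer_group_root:
  assumes "group G" and s: "s \<in> hom G integer_group" and fg: "f \<in> carrier G" "g \<in> carrier G" "s f \<noteq> 0"
  shows "\<exists>(p::int) (q::nat). q > 0 \<and> s (g [^]\<^bsub>G\<^esub> q \<otimes>\<^bsub>G\<^esub> inv\<^bsub>G\<^esub> (f [^]\<^bsub>G\<^esub> p)) = 0"
proof -
  interpret group_hom G integer_group s
    using assms by (simp add: group_hom_def group_hom_axioms_def)
  have eq: "s (g [^]\<^bsub>G\<^esub> q \<otimes>\<^bsub>G\<^esub> inv\<^bsub>G\<^esub> (f [^]\<^bsub>G\<^esub> p)) = int q * s g - p * s f" for p and q :: nat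
    using hom_nat_pow[OF fg(2)] hom_int_pow[OF fg(1)] fg by simp
  have "\<bar>s f\<bar> * s g - (s g * sgn (s f)) * s f = 0"
    by (simp add: abs_sgn mult.commute mult.left_commute)
  then have "s (g [^]\<^bsub>G\<^esub> nat \<bar>s f\<bar> \<otimes>\<^bsub>G\<^esub> inv\<^bsub>G\<^esub> (f [^]\<^bsub>G\<^esub> (s g * sgn (s f)))) = 0"
    unfolding eq by (simp only: int_nat_eq abs_ge_zero if_True)
  moreover have "nat \<bar>s f\<bar> > 0" using fg(3) by simp
  ultimately show ?thesis by blast
qed

section \<open>How commuting elements act on the gaps\<close>

context Thompson_element
begin

lemma centralizer_iff:
  "g \<in> centralizer Thompson_F f \<longleftrightarrow>
     g \<in> carrier Thompson_F \<and> (\<forall>x\<in>{0<..<1}. g (f x) = f (g x))"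
proof -
  have "g \<otimes>\<^bsub>Thompson_F\<^esub> f = f \<otimes>\<^bsub>Thompson_F\<^esub> g \<longleftrightarrow> (\<forall>x\<in>{0<..<1}. g (f x) = f (g x))"
    if "g \<in> carrier Thompson_F"
    using Thompson_F_mult[OF that f] Thompson_F_mult[OF f that]
    by (auto simp: compose_def fun_eq_iff restrict_def)
  then show ?thesis by (auto simp: centralizer_def)
qed

lemma centralizerD:
  assumes "g \<in> centralizer Thompson_F f"
  shows "g \<in> carrier Thompson_F" "pl2_bij {0<..<1} {0<..<1} g"
    "\<And>x. x \<in> {0<..<1} \<Longrightarrow> g (f x) = f (g x)"
  using assms Thompson_F_pl2_bij by (auto simp: centralizer_iff)

lemma f_in_centralizer: "f \<in> centralizer Thompson_F f"
  using f by (simp add: centralizer_iff)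

lemma centralizer_fixes_division_points:
  assumes g: "g \<in> centralizer Thompson_F f" and x: "x \<in> division_points" "x \<in> {0<..<1}"
  shows "g x = x"
proof -
  note g' = centralizerD[OF g]
  let ?A = "division_points \<inter> {0<..<1}"
  have "g y \<in> ?A" if y: "y \<in> ?A" for y
  proof -
    have gy: "g y \<in> {0<..<1}" using pl2_bij_in[OF g'(2)] y by blast
    have fy: "f y = y" "\<not> (\<forall>\<^sub>F z in nhds y. f z = z)" using y by (auto simp: division_points_def)
    \<comment> \<open>Were f the identity around \<open>g y\<close>, then continuity of g,
      commutation and cancelling g would make f the identity around y.\<close>
    have "\<not> (\<forall>\<^sub>F z in nhds (g y). f z = z)"
    proof
      assume *: "\<forall>\<^sub>F z in nhds (g y). f z = z"
      have "isCont g y" using pl2_bij_isCont[OF g'(2)] y by auto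
      then have "(g \<longlongrightarrow> g y) (nhds y)" by (simp add: continuous_within tendsto_at_iff_tendsto_nhds)
      then have "\<forall>\<^sub>F z in nhds y. f (g z) = g z" by (rule eventually_compose_filterlim[OF *])
      moreover have "\<forall>\<^sub>F z in nhds y. z \<in> {0<..<1}"
        using y by (intro eventually_nhds_in_open) auto
      ultimately have "\<forall>\<^sub>F z in nhds y. f z = z"
      proof eventually_elim
        case (elim z)
        then have "g (f z) = g z" using g'(3) by simp
        then show ?case using inj_onD[OF pl2_bij_inj[OF g'(2)]] pl2_bij_in[OF pl2_f] elim by blast
      qed
      then show False using fy by simp
    qed
    moreover have "f (g y) = g y" using g'(3)[of y] fy y by simp
    ultimately show ?thesis using gy by (auto simp: division_points_def)
  qed
  then have "g ` ?A \<subseteq> ?A" by blast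
  moreover have "strict_mono_on ?A g"
    using pl2_bij_mono[OF g'(2)] by (auto simp: strict_mono_on_def)
  ultimately show ?thesis
    using strict_mono_finite_fixes[of ?A g x] finite_division_points x by blast
qed

text \<open>The set Q is left open because two choices are used: the dyadic division points, for the
  spans of chains and the fix domains, and all division points, for single bump domains.\<close>

lemma centralizer_gap_image:
  assumes "g \<in> centralizer Thompson_F f" "Q \<subseteq> division_points" "B \<in> gaps Q"
  shows "g ` B = B"
  using centralizer_fixes_division_points[OF assms(1)] assms(2) division_points_subset
  by (intro pl2_bij_gap_image[OF centralizerD(2)[OF assms(1)] _ _ assms(3)]) auto

lemma centralizer_pl2_bij_gap:
  assumes "g \<in> centralizer Thompson_F f" "B \<in> gaps dyadic_division_points"
  shows "pl2_bij B B g"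
  using pl2_bij_subset[OF centralizerD(2)[OF assms(1)] gap_subset_unit[OF assms(2)]]
    centralizer_gap_image[OF assms(1) _ assms(2)] by blast

text \<open>The infimum of the points moved by \<open>g\<close> is fixed by \<open>f\<close>, because \<open>f\<close> preserves both the order and
  the set of these points; hence it is a non-dyadic point, where \<open>g\<close> is affine.\<close>

lemma centralizer_id_on_bump_gap:
  assumes g: "g \<in> centralizer Thompson_F f"
    and B: "{c<..<d} \<in> gaps dyadic_division_points" "\<not> {c<..<d} \<subseteq> fixpts f"
    and germ: "\<forall>\<^sub>F y in at_right c. g y = y" and x: "x \<in> {c<..<d}"
  shows "g x = x"
proof (rule ccontr)
  assume "g x \<noteq> x"
  note g' = centralizerD[OF g]
  define N where "N = {y \<in> {c<..<d}. g y \<noteq> y}"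
  define x0 where "x0 = Inf N"
  have B01: "{c<..<d} \<subseteq> {0<..<1}" using gap_subset_unit[OF B(1)] .
  have N: "x \<in> N" "N \<noteq> {}" "N \<subseteq> {c<..<d}" using x \<open>g x \<noteq> x\<close> by (auto simp: N_def)
  have bdd: "bdd_below N" using N(3) by (intro bdd_belowI[of _ c]) auto
  obtain e where e: "e > c" "\<And>y. c < y \<Longrightarrow> y < e \<Longrightarrow> g y = y"
    using germ by (auto simp: eventually_at_right_field)
  \<comment> \<open>The germ hypothesis keeps x0 away from c, so x0 lies inside the gap, where fixed
    points of f are non-dyadic.\<close>
  have "e \<le> x0" unfolding x0_def
    by (rule cInf_greatest[OF N(2)]) (use e(2) in \<open>force simp: N_def\<close>)
  moreover have "x0 \<le> x" unfolding x0_def by (rule cInf_lower[OF N(1) bdd])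
  ultimately have x0: "x0 \<in> {c<..<d}" using e(1) x by auto
  have lower: "x0 \<le> y" if "y \<in> N" for y unfolding x0_def by (rule cInf_lower[OF that bdd])
  have fB: "f y \<in> {c<..<d}" if "y \<in> {c<..<d}" for y
    using centralizer_gap_image[OF f_in_centralizer _ B(1)] that by blast
  have fN: "f y \<in> N \<longleftrightarrow> y \<in> N" if y: "y \<in> {c<..<d}" for y
  proof -
    have "g y \<in> {0<..<1}" using pl2_bij_in[OF g'(2)] y B01 by blast
    then have "f (g y) = f y \<longleftrightarrow> g y = y"
      using inj_on_eq_iff[OF pl2_bij_inj[OF pl2_f]] y B01 by blast
    moreover have "g (f y) = f (g y)" using g'(3) y B01 by blast
    ultimately show ?thesis using y fB by (auto simp: N_def)
  qed
  have preimage: "\<exists>z\<in>{c<..<d}. y = f z" if "y \<in> {c<..<d}" for y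
    using centralizer_gap_image[OF f_in_centralizer _ B(1)] that by blast
  have fless: "f y < f z \<longleftrightarrow> y < z" if "y \<in> {c<..<d}" "z \<in> {c<..<d}" for y z
    using strict_mono_on_less[OF pl2_bij_mono[OF pl2_f]] that B01 by blast
  \<comment> \<open>Every moved point is the image of a moved point, so \<open>f x0\<close> is a
    lower bound of N. The opposite inequality uses the preimage of x0.\<close>
  have "f x0 \<le> y" if y: "y \<in> N" for y
  proof -
    obtain z where z: "z \<in> {c<..<d}" "y = f z" using preimage N(3) y by blast
    then have "x0 \<le> z" using lower fN y by blast
    then show ?thesis using fless[OF z(1) x0] z(2) by simp
  qed
  then have "f x0 \<le> x0" unfolding x0_def using N(2) by (intro cInf_greatest) auto
  moreover have "\<not> f x0 < x0"
  proof
    assume "f x0 < x0"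
    obtain z where z: "z \<in> {c<..<d}" "x0 = f z" using preimage x0 by blast
    then have "x0 < z" using \<open>f x0 < x0\<close> fless[OF x0 z(1)] by simp
    then obtain y where y: "y \<in> N" "y < z" using cInf_lessD[OF N(2)] x0_def by blast
    then have "f y \<in> N" "f y < x0" using fN fless z N(3) by blast+
    then show False using lower by force
  qed
  ultimately have fx0: "f x0 = x0" by simp
  have "x0 \<notin> dyadic" using fixed_in_bump_gap(2)[OF B x0 fx0] .
  then obtain k b where kb: "\<forall>\<^sub>F y in nhds x0. g y = 2 powi (k::int) * y + b"
    using pl2_bij_locally_affine2[OF g'(2)] x0 B01 unfolding locally_affine2_def by blast
  have "\<forall>\<^sub>F y in at_left x0. y \<in> {c<..<x0}"
    using x0 by (auto simp: eventually_at_left_field)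
  moreover have "\<forall>\<^sub>F y in at_left x0. g y = 2 powi k * y + b"
    using kb by (auto simp: eventually_at_filter elim: eventually_mono)
  \<comment> \<open>No point of the gap to the left of x0 is moved, which forces the affine germ,
    valid on both sides of x0, to be the identity.\<close>
  ultimately have "\<forall>\<^sub>F y in at_left x0. 2 powi k * y + b = 1 * y + 0"
  proof eventually_elim
    case (elim y)
    then have "y \<notin> N" "y \<in> {c<..<d}" using lower[of y] x0 by auto
    then show ?case using elim by (simp add: N_def)
  qed
  then have "2 powi k = (1::real)" "b = 0" using affine_unique_at_left by blast+
  then have id: "\<forall>\<^sub>F y in nhds x0. g y = y" using kb by simp
  then have "\<forall>\<^sub>F y in at_right x0. g y = y"
    by (auto simp: eventually_at_filter elim: eventually_mono)
  then obtain u where u: "u > x0" "\<And>y. x0 < y \<Longrightarrow> y < u \<Longrightarrow> g y = y"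
    by (auto simp: eventually_at_right_field)
  have gx0: "g x0 = x0" using eventually_nhds_x_imp_x[OF id] .
  \<comment> \<open>Moved points occur arbitrarily close to the infimum, yet g is the identity on
    [x0, u).\<close>
  obtain y where y: "y \<in> N" "y < u" using cInf_lessD[OF N(2)] u(1) x0_def by blast
  then show False using lower[of y] u(2)[of y] gx0 by (cases "y = x0") (auto simp: N_def)
qed

text \<open>Neighbouring gaps need no compatibility: they are separated by dyadic division points,
  where breaks are allowed and which f fixes as well. This independence makes the centralizer a
  direct product.\<close>

lemma centralizer_glue:
  assumes pl: "\<And>B. B \<in> gaps dyadic_division_points \<Longrightarrow> pl2_bij B B (k B)"
    and comm: "\<And>B x. B \<in> gaps dyadic_division_points \<Longrightarrow> x \<in> B \<Longrightarrow> k B (f x) = f (k B x)"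
  shows "\<exists>g\<in>centralizer Thompson_F f. \<forall>B\<in>gaps dyadic_division_points. \<forall>x\<in>B. g x = k B x"
proof -
  let ?\<B> = "gaps dyadic_division_points"
  \<comment> \<open>Gaps are disjoint, so the block is unique; points in no gap are fixed.
    Restriction to (0,1) later gives the extensional representative.\<close>
  define g where "g x = (if x \<in> \<Union>?\<B> then k (THE B. B \<in> ?\<B> \<and> x \<in> B) x else x)" for x
  have g: "g x = k B x" if "B \<in> ?\<B>" "x \<in> B" for B x
  proof -
    have "(THE B. B \<in> ?\<B> \<and> x \<in> B) = B" using that gaps_eqI by (intro the_equality) blast+
    then show ?thesis using that by (auto simp: g_def)
  qed
  have union: "\<Union>?\<B> = {0<..<1} - dyadic_division_points"
    by (rule Union_gaps[OF dyadic_division_points_properties])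
  have "pl2_bij {0<..<1} {0<..<1} g"
  proof (rule pl2_bij_glue[of ?\<B>])
    show "pl2_bij B B g" if "B \<in> ?\<B>" for B
      using pl2_bij_cong[OF gaps_open[OF that] _ pl[OF that]] g[OF that] by simp
    show "finite ?\<B>" by (intro finite_gaps dyadic_division_points_properties)
    show "finite ({0<..<1} - \<Union>?\<B>)" "{0<..<1} - \<Union>?\<B> \<subseteq> dyadic" "\<Union>?\<B> \<subseteq> {0<..<1}"
      using dyadic_division_points_properties(1) unfolding union
      by (auto intro: rev_finite_subset)
  qed (auto simp: g_def gaps_interval disjnt_gaps)
  then have r: "restrict g {0<..<1} \<in> carrier Thompson_F" by (rule restrict_in_Thompson_F)
  have "g (f x) = f (g x)" if x: "x \<in> {0<..<1}" for x
  proof (cases "x \<in> \<Union>?\<B>")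
    case True
    then obtain B where B: "B \<in> ?\<B>" "x \<in> B" by blast
    then have "f x \<in> B" using centralizer_gap_image[OF f_in_centralizer] by blast
    then show ?thesis using g B comm by simp
  next
    case False
    then have "x \<in> division_points" "g x = x" using x by (auto simp: union g_def)
    then show ?thesis using f_division_point x by simp
  qed
  then have "restrict g {0<..<1} \<in> centralizer Thompson_F f"
    using r pl2_bij_in[OF pl2_f] pl2_bij_in[OF Thompson_F_pl2_bij[OF r]] by (auto simp: centralizer_iff)
  moreover have "restrict g {0<..<1} x = k B x" if "B \<in> ?\<B>" "x \<in> B" for B x
    using g that gap_subset_unit[OF that(1)] by auto
  ultimately show ?thesis by blast
qed

section \<open>Group structure of the centralizer and restriction homomorphisms\<close>

abbreviation centralizer_group :: "(real \<Rightarrow> real) monoid" where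
  "centralizer_group \<equiv> Thompson_F\<lparr>carrier := centralizer Thompson_F f\<rparr>"

lemma subgroup_centralizer: "subgroup (centralizer Thompson_F f) Thompson_F"
proof -
  interpret T: group Thompson_F by (rule group_Thompson_F)
  show ?thesis
  proof (rule T.subgroupI)
    show "centralizer Thompson_F f \<subseteq> carrier Thompson_F" by (auto simp: centralizer_def)
    show "centralizer Thompson_F f \<noteq> {}" using f_in_centralizer by blast
    show "inv\<^bsub>Thompson_F\<^esub> g \<in> centralizer Thompson_F f" if "g \<in> centralizer Thompson_F f" for g
    proof -
      have g: "g \<in> carrier Thompson_F" "g \<otimes>\<^bsub>Thompson_F\<^esub> f = f \<otimes>\<^bsub>Thompson_F\<^esub> g"
        using that by (auto simp: centralizer_def)
      then have "inv\<^bsub>Thompson_F\<^esub> g \<otimes>\<^bsub>Thompson_F\<^esub> (f \<otimes>\<^bsub>Thompson_F\<^esub> g) = f"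
        using f by (metis T.inv_solve_left T.m_closed)
      then have "inv\<^bsub>Thompson_F\<^esub> g \<otimes>\<^bsub>Thompson_F\<^esub> f = f \<otimes>\<^bsub>Thompson_F\<^esub> inv\<^bsub>Thompson_F\<^esub> g"
        using f g by (metis T.inv_closed T.inv_solve_right T.m_assoc T.m_closed)
      then show ?thesis using g by (simp add: centralizer_def)
    qed
    show "g \<otimes>\<^bsub>Thompson_F\<^esub> h \<in> centralizer Thompson_F f"
      if "g \<in> centralizer Thompson_F f" "h \<in> centralizer Thompson_F f" for g h
    proof -
      have gh: "g \<in> carrier Thompson_F" "g \<otimes>\<^bsub>Thompson_F\<^esub> f = f \<otimes>\<^bsub>Thompson_F\<^esub> g"
        "h \<in> carrier Thompson_F" "h \<otimes>\<^bsub>Thompson_F\<^esub> f = f \<otimes>\<^bsub>Thompson_F\<^esub> h"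
        using that by (auto simp: centralizer_def)
      then have "(g \<otimes>\<^bsub>Thompson_F\<^esub> h) \<otimes>\<^bsub>Thompson_F\<^esub> f = f \<otimes>\<^bsub>Thompson_F\<^esub> (g \<otimes>\<^bsub>Thompson_F\<^esub> h)"
        using f by (metis T.m_assoc)
      then show ?thesis using gh by (simp add: centralizer_def)
    qed
  qed
qed

lemma group_centralizer: "group centralizer_group"
  by (rule subgroup.subgroup_is_group[OF subgroup_centralizer group_Thompson_F])

lemma centralizer_mult:
  assumes "g \<in> centralizer Thompson_F f" "h \<in> centralizer Thompson_F f"
  shows "g \<otimes>\<^bsub>centralizer_group\<^esub> h = compose {0<..<1} g h"
  using assms Thompson_F_mult by (simp add: centralizer_def)

lemma restrict_in_Bij:
  assumes "g \<in> centralizer Thompson_F f" "D \<in> gaps Q" "Q \<subseteq> division_points" "D \<subseteq> {0<..<1}"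
  shows "restrict g D \<in> Bij D"
  using inj_on_subset[OF pl2_bij_inj[OF centralizerD(2)[OF assms(1)]] assms(4)]
    centralizer_gap_image[OF assms(1,3,2)]
  by (simp add: Bij_def bij_betw_def)

lemma restrict_hom:
  assumes "D \<in> gaps Q" "Q \<subseteq> division_points" "D \<subseteq> {0<..<1}"
  shows "(\<lambda>g. restrict g D) \<in> hom centralizer_group (BijGroup D)"
proof (rule homI)
  show "restrict g D \<in> carrier (BijGroup D)" if "g \<in> carrier centralizer_group" for g
    using restrict_in_Bij[OF _ assms] that by (simp add: BijGroup_def)
  fix g h assume "g \<in> carrier centralizer_group" "h \<in> carrier centralizer_group"
  then have gh: "g \<in> centralizer Thompson_F f" "h \<in> centralizer Thompson_F f" by simp_all
  have "h x \<in> D" if "x \<in> D" for x using centralizer_gap_image[OF gh(2) assms(2,1)] that by blast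
  then show "restrict (g \<otimes>\<^bsub>centralizer_group\<^esub> h) D = restrict g D \<otimes>\<^bsub>BijGroup D\<^esub> restrict h D"
    using gh restrict_in_Bij[OF _ assms] assms(3)
    by (subst centralizer_mult) (auto simp: BijGroup_def compose_def fun_eq_iff restrict_def)
qed

section \<open>Slope exponents and roots on bump chains\<close>

definition slope_exponent :: "real set \<Rightarrow> (real \<Rightarrow> real) \<Rightarrow> int" where
  "slope_exponent B g = (THE k. right_slope (Inf B) g k)"

lemma slope_exponent_eq: "right_slope (Inf B) g k \<Longrightarrow> slope_exponent B g = k"
  unfolding slope_exponent_def using right_slope_unique by blast

lemma right_slope_slope_exponent:
  assumes "g \<in> centralizer Thompson_F f" "B \<in> gaps dyadic_division_points"
  shows "right_slope (Inf B) g (slope_exponent B g)"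
proof -
  obtain c d where cd: "B = {c<..<d}" "c < d" using assms(2) by (rule gapsE)
  then obtain k where "right_slope (Inf B) g k"
    using right_slope_exists[of c d g] centralizer_pl2_bij_gap[OF assms] by auto
  then show ?thesis using slope_exponent_eq by simp
qed

lemma slope_exponent_hom:
  assumes B: "B \<in> gaps dyadic_division_points"
  shows "slope_exponent B \<in> hom centralizer_group integer_group"
proof (rule homI)
  fix g h assume "g \<in> carrier centralizer_group" "h \<in> carrier centralizer_group"
  then have gh: "g \<in> centralizer Thompson_F f" "h \<in> centralizer Thompson_F f" by simp_all
  obtain c d where cd: "B = {c<..<d}" "c < d" using B by (rule gapsE)
  have "right_slope c (g \<circ> h) (slope_exponent B g + slope_exponent B h)"
    using right_slope_comp right_slope_slope_exponent[OF _ B] gh cd by simp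
  then have "right_slope c (compose {0<..<1} g h) (slope_exponent B g + slope_exponent B h)"
    by (rule right_slope_cong[OF _ cd(2)])
      (use gap_subset_unit[OF B] cd(1) in \<open>auto simp: compose_def subset_iff\<close>)
  then show "slope_exponent B (g \<otimes>\<^bsub>centralizer_group\<^esub> h) =
      slope_exponent B g \<otimes>\<^bsub>integer_group\<^esub> slope_exponent B h"
    using cd by (subst centralizer_mult[OF gh]) (simp add: slope_exponent_eq)
qed simp

lemma slope_exponent_0:
  assumes g: "g \<in> centralizer Thompson_F f" "slope_exponent B g = 0"
    and B: "B \<in> gaps dyadic_division_points" "\<not> B \<subseteq> fixpts f" "x \<in> B"
  shows "g x = x"
proof -
  obtain c d where cd: "B = {c<..<d}" "c < d" using B(1) by (rule gapsE)
  have "\<forall>\<^sub>F y in at_right c. g y = y"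
    using right_slope_slope_exponent[OF g(1) B(1)] g(2) cd by (simp add: right_slope_def)
  then show ?thesis using centralizer_id_on_bump_gap[OF g(1)] B cd(1) by blast
qed

text \<open>Otherwise f itself would be the identity on B.\<close>

lemma slope_exponent_f:
  assumes "B \<in> gaps dyadic_division_points" "\<not> B \<subseteq> fixpts f"
  shows "slope_exponent B f \<noteq> 0"
  using slope_exponent_0[OF f_in_centralizer _ assms] assms gap_subset_unit[OF assms(1)]
  by (auto simp: fixpts_def)

text \<open>One pair p, q serves the whole chain because the exponent belongs to the span B and not
  to its members. The product of the q-th power of g and the inverse of the p-th power of f has
  exponent 0, so it is the identity on B; restriction to a member D is a homomorphism into
  \<open>BijGroup D\<close> and turns this into the equation of powers.\<close>

lemma centralizer_root:
  assumes g: "g \<in> centralizer Thompson_F f"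
    and B: "B \<in> gaps dyadic_division_points" "\<not> B \<subseteq> fixpts f"
  shows "\<exists>(p::int) (q::nat). q > 0 \<and> (\<forall>D\<in>gaps division_points. D \<subseteq> B \<longrightarrow>
    restrict g D [^]\<^bsub>BijGroup D\<^esub> q = restrict f D [^]\<^bsub>BijGroup D\<^esub> p)"
proof -
  let ?G = centralizer_group
  interpret C: group ?G by (rule group_centralizer)
  have mem: "f \<in> carrier ?G" "g \<in> carrier ?G"
    using g f_in_centralizer by simp_all
  obtain p :: int and q :: nat where q: "q > 0"
    and s0: "slope_exponent B (g [^]\<^bsub>?G\<^esub> q \<otimes>\<^bsub>?G\<^esub> inv\<^bsub>?G\<^esub> (f [^]\<^bsub>?G\<^esub> p)) = 0"
    using hom_integer_group_root[where s = "slope_exponent B" and f = f,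
        OF C.is_group slope_exponent_hom[OF B(1)] mem slope_exponent_f[OF B]]
    by blast
  define a where "a = g [^]\<^bsub>?G\<^esub> q"
  define b where "b = f [^]\<^bsub>?G\<^esub> p"
  have ab: "a \<in> carrier ?G" "b \<in> carrier ?G"
    unfolding a_def b_def using mem by (blast intro: C.nat_pow_closed C.int_pow_closed)+
  then have h: "a \<otimes>\<^bsub>?G\<^esub> inv\<^bsub>?G\<^esub> b \<in> carrier ?G"
    by (intro C.m_closed C.inv_closed)
  have h_id: "(a \<otimes>\<^bsub>?G\<^esub> inv\<^bsub>?G\<^esub> b) x = x" if "x \<in> B" for x
    using slope_exponent_0[OF _ _ B that] h s0 unfolding a_def b_def by simp
  have "restrict g D [^]\<^bsub>BijGroup D\<^esub> q = restrict f D [^]\<^bsub>BijGroup D\<^esub> p"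
    if D: "D \<in> gaps division_points" "D \<subseteq> B" for D
  proof -
    interpret r: group_hom ?G "BijGroup D" "\<lambda>g. restrict g D"
      using restrict_hom[OF D(1)] D(2) gap_subset_unit[OF B(1)] group_BijGroup
      by (simp add: group_hom_def group_hom_axioms_def C.is_group)
    have "restrict (a \<otimes>\<^bsub>?G\<^esub> inv\<^bsub>?G\<^esub> b) D = restrict (\<lambda>x. x) D"
      by (rule restrict_ext) (use h_id D(2) in blast)
    then have "\<one>\<^bsub>BijGroup D\<^esub> = restrict a D \<otimes>\<^bsub>BijGroup D\<^esub> inv\<^bsub>BijGroup D\<^esub> restrict b D"
      using r.hom_mult[OF ab(1) C.inv_closed[OF ab(2)]] r.hom_inv[OF ab(2)] by (simp add: BijGroup_def)
    then have "restrict a D = restrict b D"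
      using r.H.inv_solve_right'[OF r.H.one_closed r.hom_closed[OF ab(1)] r.hom_closed[OF ab(2)]]
        r.hom_closed[OF ab(2)] r.H.l_one by metis
    then show ?thesis
      unfolding a_def b_def using r.hom_nat_pow[OF mem(2)] r.hom_int_pow[OF mem(1)] by metis
  qed
  then show ?thesis using q by blast
qed

text \<open>The element h is g on C glued to the identity on all other gaps; it lies in F because
  the ends of C are dyadic.\<close>

lemma centralizer_restrict_fix_domain:
  assumes g: "g \<in> centralizer Thompson_F f" and C: "C \<in> fix_domains f"
  shows "\<exists>h\<in>Thompson_F_on C. restrict g C = restrict h C"
proof -
  have B: "C \<in> gaps dyadic_division_points" "C \<subseteq> fixpts f" using C by (auto simp: fix_domains_eq)
  have "\<exists>h\<in>centralizer Thompson_F f. \<forall>B\<in>gaps dyadic_division_points. \<forall>x\<in>B.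
      h x = (if B = C then g else (\<lambda>x. x)) x"
  proof (rule centralizer_glue)
    fix B x assume "B \<in> gaps dyadic_division_points"
    then show "pl2_bij B B (if B = C then g else (\<lambda>x. x))"
      using centralizer_pl2_bij_gap[OF g, of B] pl2_bij_id by auto
    assume "x \<in> B"
    then have "x \<in> {0<..<1}" using gap_subset_unit \<open>B \<in> _\<close> by blast
    then show "(if B = C then g else (\<lambda>x. x)) (f x) = f ((if B = C then g else (\<lambda>x. x)) x)"
      using centralizerD(3)[OF g] by simp
  qed
  then obtain h where h: "h \<in> centralizer Thompson_F f"
    "\<And>B x. B \<in> gaps dyadic_division_points \<Longrightarrow> x \<in> B \<Longrightarrow> h x = (if B = C then g else (\<lambda>x. x)) x"
    by blast
  have "h x = x" if x: "x \<in> {0<..<1} - C" for x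
  proof (cases "x \<in> division_points")
    case True
    then show ?thesis using centralizer_fixes_division_points[OF h(1)] x by blast
  next
    case False
    then obtain B where "B \<in> gaps dyadic_division_points" "x \<in> B"
      using Union_gaps[OF dyadic_division_points_properties] x by blast
    then show ?thesis using h(2)[of B x] x by auto
  qed
  then have "h \<in> Thompson_F_on C" using centralizerD(1)[OF h(1)] by (simp add: Thompson_F_on_def)
  moreover have "restrict g C = restrict h C" using h(2)[OF B(1)] by (auto simp: restrict_def fun_eq_iff)
  ultimately show ?thesis by blast
qed

text \<open>By injectivity h preserves C, and f maps no outside point into C. On C the map f is the
  identity, off C the map h is, so they commute.\<close>

lemma Thompson_F_on_fix_domain_subset_centralizer:
  assumes h: "h \<in> Thompson_F_on C" and C: "C \<in> fix_domains f"
  shows "h \<in> centralizer Thompson_F f"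
proof -
  have fixed: "f x = x" "x \<in> {0<..<1}" if "x \<in> C" for x
    using C that by (auto simp: fix_domains_def fixpts_def)
  have h': "h \<in> carrier Thompson_F" "\<And>x. x \<in> {0<..<1} - C \<Longrightarrow> h x = x"
    using h by (auto simp: Thompson_F_on_def)
  note hp = Thompson_F_pl2_bij[OF h'(1)]
  have hC: "h x \<in> C" if "x \<in> C" for x
  proof (rule ccontr)
    assume nC: "h x \<notin> C"
    have hx: "h x \<in> {0<..<1}" using pl2_bij_in[OF hp] fixed that by blast
    then have "h (h x) = h x" using h'(2) nC by blast
    then have "h x = x" using inj_onD[OF pl2_bij_inj[OF hp]] hx fixed that by blast
    then show False using nC that by simp
  qed
  have "h (f x) = f (h x)" if x: "x \<in> {0<..<1}" for x
  proof (cases "x \<in> C")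
    case True
    then show ?thesis using fixed hC by simp
  next
    case False
    have fx: "f x \<in> {0<..<1}" using pl2_bij_in[OF pl2_f x] .
    have "f x \<notin> C"
    proof
      assume "f x \<in> C"
      then have "f (f x) = f x" using fixed by blast
      then have "f x = x" using inj_onD[OF pl2_bij_inj[OF pl2_f]] fx x by blast
      then show False using \<open>f x \<in> C\<close> False by simp
    qed
    then show ?thesis using h'(2) fx x False by simp
  qed
  then show ?thesis using h'(1) by (simp add: centralizer_iff)
qed

section \<open>Charts carrying the action on a gap to the unit interval\<close>

definition chart :: "real set \<Rightarrow> real \<Rightarrow> real" where
  "chart C = (SOME \<phi>. pl2_bij {0<..<1} C \<phi>)"

lemma pl2_bij_chart:
  assumes "C \<in> gaps dyadic_division_points"
  shows "pl2_bij {0<..<1} C (chart C)"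
proof -
  obtain c d where "C = {c<..<d}" "c \<in> dyadic" "d \<in> dyadic" "c < d"
    using assms by (auto elim: gapsE)
  then show ?thesis unfolding chart_def using exists_pl2_bij by (metis someI_ex)
qed

text \<open>On a fix domain C this is the identification of \<open>Thompson_F_on C\<close> with F,
  applied to the part of g living on C. The restriction makes the result extensional.\<close>

definition conjugate_chart :: "real set \<Rightarrow> (real \<Rightarrow> real) \<Rightarrow> real \<Rightarrow> real" where
  "conjugate_chart C g = restrict (inv_into {0<..<1} (chart C) \<circ> g \<circ> chart C) {0<..<1}"

lemma chart_inverse:
  assumes "C \<in> gaps dyadic_division_points"
  shows "y \<in> C \<Longrightarrow> chart C (inv_into {0<..<1} (chart C) y) = y"
    and "x \<in> {0<..<1} \<Longrightarrow> inv_into {0<..<1} (chart C) (chart C x) = x"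
  using pl2_bij_image[OF pl2_bij_chart[OF assms]] pl2_bij_inj[OF pl2_bij_chart[OF assms]]
  by (auto simp: f_inv_into_f)

lemma chart_conjugate_chart:
  assumes C: "C \<in> gaps dyadic_division_points" and g: "g \<in> centralizer Thompson_F f" and x: "x \<in> {0<..<1}"
  shows "chart C (conjugate_chart C g x) = g (chart C x)"
proof -
  have "g (chart C x) \<in> C"
    using pl2_bij_in[OF centralizer_pl2_bij_gap[OF g C]] pl2_bij_in[OF pl2_bij_chart[OF C] x] .
  then show ?thesis using x chart_inverse(1)[OF C] by (simp add: conjugate_chart_def)
qed

lemma conjugate_chart_in_Thompson_F:
  assumes C: "C \<in> gaps dyadic_division_points" and g: "g \<in> centralizer Thompson_F f"
  shows "conjugate_chart C g \<in> carrier Thompson_F"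
  unfolding conjugate_chart_def
  by (intro restrict_in_Thompson_F pl2_bij_comp[OF pl2_bij_chart[OF C]]
      pl2_bij_comp[OF centralizer_pl2_bij_gap[OF g C]] pl2_bij_inv_into[OF pl2_bij_chart[OF C]]) simp

text \<open>Checking that the chart intertwines g and h avoids handling the inverse chart; both
  multiplicativity and surjectivity are verified in this form.\<close>

lemma conjugate_chart_eqI:
  assumes C: "C \<in> gaps dyadic_division_points" and g: "g \<in> centralizer Thompson_F f"
    and h: "h \<in> carrier Thompson_F" and eq: "\<And>x. x \<in> {0<..<1} \<Longrightarrow> g (chart C x) = chart C (h x)"
  shows "conjugate_chart C g = h"
proof (rule Thompson_F_eqI[OF conjugate_chart_in_Thompson_F[OF C g] h])
  fix x :: real assume x: "x \<in> {0<..<1}"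
  then show "conjugate_chart C g x = h x"
    using eq chart_inverse(2)[OF C pl2_bij_in[OF Thompson_F_pl2_bij[OF h] x]]
    by (simp add: conjugate_chart_def)
qed

lemma conjugate_chart_hom:
  assumes C: "C \<in> gaps dyadic_division_points"
  shows "conjugate_chart C \<in> hom centralizer_group Thompson_F"
proof (rule homI)
  show "conjugate_chart C g \<in> carrier Thompson_F" if "g \<in> carrier centralizer_group" for g
    using conjugate_chart_in_Thompson_F[OF C] that by simp
  fix g h assume "g \<in> carrier centralizer_group" "h \<in> carrier centralizer_group"
  then have gh: "g \<in> centralizer Thompson_F f" "h \<in> centralizer Thompson_F f" by simp_all
  let ?c = "conjugate_chart C"
  have mem: "?c g \<in> carrier Thompson_F" "?c h \<in> carrier Thompson_F"
    using conjugate_chart_in_Thompson_F[OF C] gh by blast+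
  show "?c (g \<otimes>\<^bsub>centralizer_group\<^esub> h) = ?c g \<otimes>\<^bsub>Thompson_F\<^esub> ?c h"
  proof (rule conjugate_chart_eqI[OF C])
    show "g \<otimes>\<^bsub>centralizer_group\<^esub> h \<in> centralizer Thompson_F f"
      using group.is_monoid[OF group_centralizer] gh monoid.m_closed by fastforce
    show "?c g \<otimes>\<^bsub>Thompson_F\<^esub> ?c h \<in> carrier Thompson_F"
      using mem group.is_monoid[OF group_Thompson_F] by (simp add: monoid.m_closed)
    fix x :: real assume x: "x \<in> {0<..<1}"
    have "chart C x \<in> {0<..<1}"
      using pl2_bij_in[OF pl2_bij_chart[OF C] x] gap_subset_unit[OF C] by blast
    moreover have "?c h x \<in> {0<..<1}" using pl2_bij_in[OF Thompson_F_pl2_bij[OF mem(2)] x] .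
    ultimately show "(g \<otimes>\<^bsub>centralizer_group\<^esub> h) (chart C x) = chart C ((?c g \<otimes>\<^bsub>Thompson_F\<^esub> ?c h) x)"
      unfolding centralizer_mult[OF gh] Thompson_F_mult[OF mem]
      using x chart_conjugate_chart[OF C gh(1)] chart_conjugate_chart[OF C gh(2)]
      by (simp add: compose_def)
  qed
qed

text \<open>This gives the trivial kernel of the coordinate map: division points are always fixed,
  charts detect movement on fix domains, and slope exponents detect it on bump gaps.\<close>

lemma centralizer_eq_oneI:
  assumes g: "g \<in> centralizer Thompson_F f"
    and fix_part: "\<And>C. C \<in> fix_domains f \<Longrightarrow> conjugate_chart C g = \<one>\<^bsub>Thompson_F\<^esub>"
    and bump: "\<And>B. B \<in> gaps dyadic_division_points \<Longrightarrow> \<not> B \<subseteq> fixpts f \<Longrightarrow> slope_exponent B g = 0"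
  shows "g = \<one>\<^bsub>centralizer_group\<^esub>"
proof -
  have "g x = x" if x: "x \<in> {0<..<1}" for x
  proof (cases "x \<in> division_points")
    case True
    then show ?thesis using centralizer_fixes_division_points[OF g] x by blast
  next
    case False
    then obtain B where B: "B \<in> gaps dyadic_division_points" "x \<in> B"
      using Union_gaps[OF dyadic_division_points_properties] x by blast
    show ?thesis
    proof (cases "B \<subseteq> fixpts f")
      case True
      then have one: "conjugate_chart B g = \<one>\<^bsub>Thompson_F\<^esub>" using fix_part B by (simp add: fix_domains_eq)
      obtain t where t: "t \<in> {0<..<1}" "x = chart B t"
        using B pl2_bij_image[OF pl2_bij_chart[OF B(1)]] by blast
      then show ?thesis using chart_conjugate_chart[OF B(1) g t(1)] by (simp add: one Thompson_F_one)
    next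
      case False
      then show ?thesis using slope_exponent_0[OF g _ B(1) _ B(2)] bump[OF B(1)] by blast
    qed
  qed
  then show ?thesis
    using g by (auto simp: centralizer_iff Thompson_F_iff Thompson_F_one intro: extensionalityI[of _ "{0<..<1}"])
qed

text \<open>Conjugation by the charts identifies the parts of the centralizer supported on the fix domains
  with Thompson's group; on the bump gaps the slope exponents, divided by the generators of their
  ranges, are coordinates.\<close>

lemma centralizer_isomorphic:
  assumes e: "bij_betw e I (fix_domains f)"
    and e': "bij_betw e' J {B \<in> gaps dyadic_division_points. \<not> B \<subseteq> fixpts f}"
  shows "centralizer_group \<cong> product_group I (\<lambda>_. Thompson_F) \<times>\<times> product_group J (\<lambda>_. integer_group)"
proof -
  let ?G = centralizer_group
  let ?H = "product_group I (\<lambda>_. Thompson_F) \<times>\<times> product_group J (\<lambda>_. integer_group)"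
  have eI: "e i \<in> gaps dyadic_division_points" "e i \<subseteq> fixpts f" if "i \<in> I" for i
    using bij_betwE[OF e] that by (auto simp: fix_domains_eq)
  have eJ: "e' j \<in> gaps dyadic_division_points" "\<not> e' j \<subseteq> fixpts f" if "j \<in> J" for j
    using bij_betwE[OF e'] that by auto
  interpret G: group ?G by (rule group_centralizer)
  \<comment> \<open>The range of the exponent on each bump gap is non-zero because of f;
    \<open>n j\<close> generates it and \<open>y j\<close> attains it.\<close>
  have "\<exists>n>0. \<exists>y\<in>carrier ?G. slope_exponent (e' j) y = n \<and> (\<forall>z\<in>carrier ?G. n dvd slope_exponent (e' j) z)"
    if "j \<in> J" for j
    by (rule hom_integer_group_generator[of _ _ f])
      (use eJ[OF that] slope_exponent_hom slope_exponent_f f_in_centralizer G.is_group in simp_all)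
  then obtain n y where ny: "\<And>j. j \<in> J \<Longrightarrow> n j > 0" "\<And>j. j \<in> J \<Longrightarrow> y j \<in> carrier ?G"
    "\<And>j. j \<in> J \<Longrightarrow> slope_exponent (e' j) (y j) = n j"
    "\<And>j z. j \<in> J \<Longrightarrow> z \<in> carrier ?G \<Longrightarrow> n j dvd slope_exponent (e' j) z"
    by metis
  define \<Psi> where "\<Psi> g = (\<lambda>i\<in>I. conjugate_chart (e i) g, \<lambda>j\<in>J. slope_exponent (e' j) g div n j)" for g
  have "\<Psi> \<in> hom ?G ?H"
  proof (rule homI)
    show "\<Psi> g \<in> carrier ?H" if "g \<in> carrier ?G" for g
      using that conjugate_chart_in_Thompson_F[OF eI(1)] by (auto simp: \<Psi>_def)
    fix g h assume gh: "g \<in> carrier ?G" "h \<in> carrier ?G"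
    have "conjugate_chart (e i) (g \<otimes>\<^bsub>?G\<^esub> h) = conjugate_chart (e i) g \<otimes>\<^bsub>Thompson_F\<^esub> conjugate_chart (e i) h"
      if "i \<in> I" for i
      using hom_mult[OF conjugate_chart_hom[OF eI(1)[OF that]] gh] .
    \<comment> \<open>Integer division is additive here because \<open>n j\<close> divides both
      exponents.\<close>
    moreover have "slope_exponent (e' j) (g \<otimes>\<^bsub>?G\<^esub> h) div n j =
        slope_exponent (e' j) g div n j + slope_exponent (e' j) h div n j" if "j \<in> J" for j
      using hom_mult[OF slope_exponent_hom[OF eJ(1)[OF that]] gh] ny(4)[OF that gh(1)]
      by (simp add: div_plus_div_distrib_dvd_left)
    ultimately show "\<Psi> (g \<otimes>\<^bsub>?G\<^esub> h) = \<Psi> g \<otimes>\<^bsub>?H\<^esub> \<Psi> h"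
      unfolding \<Psi>_def by (auto simp: fun_eq_iff restrict_def)
  qed
  then interpret P: group_hom ?G ?H \<Psi>
    by (simp add: group_hom_def group_hom_axioms_def G.is_group DirProd_group group_Thompson_F)
  have "\<Psi> \<in> iso ?G ?H"
    unfolding P.iso_iff
  proof (intro conjI ballI impI subsetI)
    fix g assume g: "g \<in> carrier ?G" and one: "\<Psi> g = \<one>\<^bsub>?H\<^esub>"
    then have coords: "(\<lambda>i\<in>I. conjugate_chart (e i) g) = (\<lambda>i\<in>I. \<one>\<^bsub>Thompson_F\<^esub>)"
      "(\<lambda>j\<in>J. slope_exponent (e' j) g div n j) = (\<lambda>j\<in>J. 0)"
      by (simp_all add: \<Psi>_def)
    have 1: "conjugate_chart (e i) g = \<one>\<^bsub>Thompson_F\<^esub>" if "i \<in> I" for i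
      using fun_cong[OF coords(1), of i] that by simp
    have 2: "slope_exponent (e' j) g div n j = 0" if "j \<in> J" for j
      using fun_cong[OF coords(2), of j] that by simp
    show "g = \<one>\<^bsub>?G\<^esub>"
    proof (rule centralizer_eq_oneI)
      show "g \<in> centralizer Thompson_F f" using g by simp
      show "conjugate_chart C g = \<one>\<^bsub>Thompson_F\<^esub>" if "C \<in> fix_domains f" for C
      proof -
        have "C \<in> e ` I" using that bij_betw_imp_surj_on[OF e] by simp
        then show ?thesis using 1 by auto
      qed
      show "slope_exponent B g = 0" if B: "B \<in> gaps dyadic_division_points" "\<not> B \<subseteq> fixpts f" for B
      proof -
        have "B \<in> e' ` J" using B bij_betw_imp_surj_on[OF e'] by simp
        then obtain j where j: "j \<in> J" "B = e' j" by blast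
        then show ?thesis using 2[OF j(1)] ny(4)[OF j(1) g] by (metis dvd_div_eq_0_iff)
      qed
    qed
  next
    fix w assume "w \<in> carrier ?H"
    \<comment> \<open>Every integer is an admissible value of z, so only the extensionality of z is
      recorded.\<close>
    then obtain a z where w: "w = (a, z)" and a: "a \<in> (\<Pi>\<^sub>E i\<in>I. carrier Thompson_F)" and z: "z \<in> extensional J"
      by (auto simp: PiE_def)
    have aT: "a i \<in> carrier Thompson_F" if "i \<in> I" for i using a that by blast
    \<comment> \<open>A preimage of (a, z) is prescribed gap by gap: on a fix domain the given
      element of F, carried over by the chart; on a bump gap the given power of the chosen
      y.\<close>
    define k where "k B = (if B \<subseteq> fixpts f
      then chart B \<circ> (a (inv_into I e B) \<circ> inv_into {0<..<1} (chart B))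
      else y (inv_into J e' B) [^]\<^bsub>?G\<^esub> z (inv_into J e' B))" for B
    have invJ: "inv_into J e' (e' j) = j" if "j \<in> J" for j
      using e' that by (simp add: bij_betw_def)
    have invI: "inv_into I e (e i) = i" if "i \<in> I" for i
      using e that by (simp add: bij_betw_def)
    have power: "y j [^]\<^bsub>?G\<^esub> z j \<in> centralizer Thompson_F f" if "j \<in> J" for j
      using G.int_pow_closed[OF ny(2)[OF that]] by simp
    have k_fix: "pl2_bij B B (k B)" if B: "B \<in> gaps dyadic_division_points" "B \<subseteq> fixpts f" for B
    proof -
      have "B \<in> e ` I" using B e by (simp add: bij_betw_def fix_domains_eq)
      then have "a (inv_into I e B) \<in> carrier Thompson_F" using aT invI by auto
      then show ?thesis
        using B pl2_bij_comp[OF pl2_bij_comp[OF pl2_bij_inv_into[OF pl2_bij_chart] Thompson_F_pl2_bij]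
            pl2_bij_chart] by (simp add: k_def)
    qed
    have k_bump: "k B \<in> centralizer Thompson_F f"
      if B: "B \<in> gaps dyadic_division_points" "\<not> B \<subseteq> fixpts f" for B
    proof -
      have "B \<in> e' ` J" using B e' by (simp add: bij_betw_def)
      then show ?thesis using power invJ B by (auto simp: k_def)
    qed
    have "\<exists>g\<in>centralizer Thompson_F f. \<forall>B\<in>gaps dyadic_division_points. \<forall>x\<in>B. g x = k B x"
    proof (rule centralizer_glue)
      fix B assume B: "B \<in> gaps dyadic_division_points"
      show pl: "pl2_bij B B (k B)"
        using k_fix[OF B] centralizer_pl2_bij_gap[OF k_bump[OF B] B] by blast
      fix x assume x: "x \<in> B"
      show "k B (f x) = f (k B x)"
      proof (cases "B \<subseteq> fixpts f")
        case True
        then have "f x = x" "f (k B x) = k B x"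
          using x pl2_bij_in[OF pl x] by (auto simp: fixpts_def)
        then show ?thesis by simp
      next
        case False
        then show ?thesis using centralizerD(3)[OF k_bump[OF B]] gap_subset_unit[OF B] x by blast
      qed
    qed
    then obtain g where g: "g \<in> centralizer Thompson_F f"
      and gk: "\<And>B x. B \<in> gaps dyadic_division_points \<Longrightarrow> x \<in> B \<Longrightarrow> g x = k B x" by blast
    have "conjugate_chart (e i) g = a i" if i: "i \<in> I" for i
    proof (rule conjugate_chart_eqI[OF eI(1)[OF i] g aT[OF i]])
      fix x :: real assume x: "x \<in> {0<..<1}"
      then have "g (chart (e i) x) = k (e i) (chart (e i) x)"
        using gk[OF eI(1)[OF i]] pl2_bij_in[OF pl2_bij_chart[OF eI(1)[OF i]]] by blast
      then show "g (chart (e i) x) = chart (e i) (a i x)"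
        using eI(2)[OF i] invI[OF i] chart_inverse(2)[OF eI(1)[OF i] x] by (simp add: k_def)
    qed
    moreover have "slope_exponent (e' j) g div n j = z j" if j: "j \<in> J" for j
    proof -
      have B: "e' j \<in> gaps dyadic_division_points" using eJ(1)[OF j] .
      interpret s: group_hom ?G integer_group "slope_exponent (e' j)"
        using slope_exponent_hom[OF B] by (simp add: group_hom_def group_hom_axioms_def G.is_group)
      obtain c d where cd: "e' j = {c<..<d}" "c < d" using B by (rule gapsE)
      have "right_slope c (y j [^]\<^bsub>?G\<^esub> z j) (slope_exponent (e' j) (y j [^]\<^bsub>?G\<^esub> z j))"
        using right_slope_slope_exponent[OF power[OF j] B] cd by simp
      moreover have "y j [^]\<^bsub>?G\<^esub> z j = k (e' j)"
        using eJ(2)[OF j] invJ[OF j] by (simp add: k_def)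
      \<comment> \<open>Agreement of g with the power on this one gap suffices, since the exponent
        depends only on the germ at c.\<close>
      ultimately have "right_slope c g (slope_exponent (e' j) (y j [^]\<^bsub>?G\<^esub> z j))"
        using right_slope_cong[OF _ cd(2)] gk[OF B] cd(1) by metis
      then have "slope_exponent (e' j) g = slope_exponent (e' j) (y j [^]\<^bsub>?G\<^esub> z j)"
        using slope_exponent_eq[of "e' j"] cd by simp
      also have "\<dots> = z j * n j" using s.hom_int_pow[OF ny(2)[OF j]] ny(3)[OF j] by simp
      finally show ?thesis using ny(1)[OF j] by simp
    qed
    ultimately have "\<Psi> g = w"
      using a z unfolding \<Psi>_def w
      by (auto simp: fun_eq_iff restrict_def PiE_def extensional_def)
    then show "w \<in> \<Psi> ` carrier ?G" using g by auto
  qed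
  then show ?thesis by (rule is_isoI)
qed

end

theorem theorem7p2:
  fixes f :: "real \<Rightarrow> real"
  assumes "f \<in> carrier Thompson_F"
  shows "(\<forall>g \<in> centralizer Thompson_F f. \<forall>Ds \<in> bump_chains f.
            \<exists>(p::int) (q::nat). q > 0 \<and>
              (\<forall>D \<in> set Ds. restrict f D \<in> Bij D \<and> restrict g D \<in> Bij D \<and>
                 restrict g D [^]\<^bsub>BijGroup D\<^esub> q = restrict f D [^]\<^bsub>BijGroup D\<^esub> p)) \<and>
         (\<forall>C \<in> fix_domains f.
            (\<forall>g \<in> centralizer Thompson_F f. \<exists>h \<in> Thompson_F_on C. restrict g C = restrict h C) \<and>
            (\<forall>h \<in> Thompson_F_on C. \<exists>g \<in> centralizer Thompson_F f. restrict g C = restrict h C)) \<and>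
         finite (fix_domains f) \<and> finite (bump_chains f) \<and>
         Thompson_F\<lparr>carrier := centralizer Thompson_F f\<rparr> \<cong>
           product_group {..<card (fix_domains f)} (\<lambda>_. Thompson_F) \<times>\<times>
           product_group {..<card (bump_chains f)} (\<lambda>_. integer_group)"
proof -
  interpret Thompson_element f by unfold_locales (rule assms)
  let ?bumps = "{B \<in> gaps dyadic_division_points. \<not> B \<subseteq> fixpts f}"
  obtain \<beta> where \<beta>: "bij_betw \<beta> (bump_chains f) ?bumps"
    and sub: "\<And>Ds D. Ds \<in> bump_chains f \<Longrightarrow> D \<in> set Ds \<Longrightarrow> D \<in> gaps division_points \<and> D \<subseteq> \<beta> Ds"
    using bump_chains_bij by blast
  have fin: "finite (gaps dyadic_division_points)"
    by (intro finite_gaps dyadic_division_points_properties)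
  then have fin_fix: "finite (fix_domains f)" by (simp add: fix_domains_eq)
  have fin_bump: "finite (bump_chains f)" using bij_betw_finite[OF \<beta>] fin by simp
  obtain e where e: "bij_betw e {..<card (fix_domains f)} (fix_domains f)"
    using ex_bij_betw_nat_finite[OF fin_fix] by (auto simp: lessThan_atLeast0)
  obtain e' where e': "bij_betw e' {..<card (bump_chains f)} (bump_chains f)"
    using ex_bij_betw_nat_finite[OF fin_bump] by (auto simp: lessThan_atLeast0)
  have "\<exists>(p::int) (q::nat). q > 0 \<and>
      (\<forall>D \<in> set Ds. restrict f D \<in> Bij D \<and> restrict g D \<in> Bij D \<and>
         restrict g D [^]\<^bsub>BijGroup D\<^esub> q = restrict f D [^]\<^bsub>BijGroup D\<^esub> p)"
    if g: "g \<in> centralizer Thompson_F f" and Ds: "Ds \<in> bump_chains f" for g Ds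
  proof -
    have B: "\<beta> Ds \<in> gaps dyadic_division_points" "\<not> \<beta> Ds \<subseteq> fixpts f"
      using bij_betwE[OF \<beta>] Ds by auto
    obtain p q where pq: "q > 0" "\<And>D. D \<in> gaps division_points \<Longrightarrow> D \<subseteq> \<beta> Ds \<Longrightarrow>
        restrict g D [^]\<^bsub>BijGroup D\<^esub> (q::nat) = restrict f D [^]\<^bsub>BijGroup D\<^esub> (p::int)"
      using centralizer_root[OF g B] by blast
    have "restrict h D \<in> Bij D" if "h \<in> centralizer Thompson_F f" "D \<in> set Ds" for h D
      using restrict_in_Bij[OF that(1)] sub[OF Ds that(2)] gap_subset_unit[OF B(1)] by blast
    then show ?thesis using pq sub[OF Ds] f_in_centralizer g by blast
  qed
  \<comment> \<open>In the converse on fix domains g is h itself. Composing with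
    \<open>\<beta>\<close> indexes the bump gaps, which carry the slope coordinates, by the bump
    chains.\<close>
  then show ?thesis
    using centralizer_restrict_fix_domain Thompson_F_on_fix_domain_subset_centralizer fin_fix fin_bump
      centralizer_isomorphic[OF e bij_betw_trans[OF e' \<beta>]] by blast
qed

end
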